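(* Let $\mathcal{H}$ be a nontrivial complex Hilbert space, let $A\in\mathcal{B}(\mathcal{H})$ be positive and nonzero, and let $T\in\mathcal{B}_A(\mathcal{H})$. The following statements are equivalent: (1) $d\omega_A(T)=\sqrt{\omega_A(T)^2+\|T\|_A^4}$. (2) There exists a sequence $\{x_n\}$ of $A$-unit vectors in $\mathcal{H}$ such that $\lim_{n\to\infty}|\langle T^2x_n,x_n\rangle_A|=\|T\|_A^2$. (3) There exists a sequence $\{x_n\}$ of $A$-unit vectors in $\mathcal{H}$ such that $\lim_{n\to\infty}|\langle TT^{\sharp_A}Tx_n,x_n\rangle_A|=\|T\|_A^3$. (4) $\omega_A(T^2)=\|T\|_A^2$.
   Context: $\mathcal{B}(\mathcal{H})$ denotes the bounded linear operators on $\mathcal{H}$. Positive means $\langle Ax,x\rangle\ge 0$ for all $x$. Put $\langle x,y\rangle_A=\langle Ax,y\rangle$ and $\|x\|_A=\sqrt{\langle x,x\rangle_A}$; $x$ is an $A$-unit vector if $\|x\|_A=1$. $\mathcal{B}_A(\mathcal{H})=\{T\in\mathcal{B}(\mathcal{H}) : \mathcal{R}(T^*A)\subseteq\mathcal{R}(A)\}$ ($\mathcal{R}$ denotes range); every $T\in\mathcal{B}_A(\mathcal{H})$ is $A$-bounded, i.e. there is $c>0$ with $\|Tx\|_A\le c\|x\|_A$ for all $x$, and $\|T\|_A=\sup\{\|Tx\|_A : \|x\|_A=1\}<\infty$. For $T\in\mathcal{B}_A(\mathcal{H})$, $T^{\sharp_A}$ is the unique $X\in\mathcal{B}(\mathcal{H})$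 with $AX=T^*A$ and $\mathcal{R}(X)\subseteq\overline{\mathcal{R}(A)}$. The $A$-numerical radius is $\omega_A(T)=\sup\{|\langle Tx,x\rangle_A| : \|x\|_A=1\}$. The $A$-Davis-Wielandt radius is $d\omega_A(T)=\sup\{\sqrt{|\langle Tx,x\rangle_A|^2+\|Tx\|_A^4} : \|x\|_A=1\}$. *)

theory Defs
  imports "HOL-Analysis.Analysis"
begin

text \<open>
  Complex Hilbert spaces are modelled on top of the library's real inner product spaces:
  the topology, norm and completeness are those of the underlying real space, whose inner
  product is the real part of the complex one. The complex inner product is linear in its
  first argument and conjugate-linear in the second.
\<close>

class scaleC =
  fixes scaleC :: "complex \<Rightarrow> 'a \<Rightarrow> 'a"  (infixr "*\<^sub>C" 75)

class complex_vector = real_vector + scaleC +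
  assumes scaleC_add_right: "c *\<^sub>C (x + y) = c *\<^sub>C x + c *\<^sub>C y"
    and scaleC_add_left: "(c + d) *\<^sub>C x = c *\<^sub>C x + d *\<^sub>C x"
    and scaleC_scaleC: "c *\<^sub>C d *\<^sub>C x = (c * d) *\<^sub>C x"
    and scaleC_one: "1 *\<^sub>C x = x"
    and scaleR_scaleC: "r *\<^sub>R x = complex_of_real r *\<^sub>C x"

text \<open>
  Positive definiteness of \<open>cinner\<close>, and the fact that it induces the norm, follow from
  \<open>inner_eq_Re_cinner\<close> and conjugate symmetry.
\<close>

class complex_inner = complex_vector + real_inner +
  fixes cinner :: "'a \<Rightarrow> 'a \<Rightarrow> complex"
  assumes cinner_commute: "cinner x y = cnj (cinner y x)"
    and cinner_add_left: "cinner (x + y) z = cinner x z + cinner y z"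
    and cinner_scaleC_left: "cinner (c *\<^sub>C x) y = c * cinner x y"
    and inner_eq_Re_cinner: "inner x y = Re (cinner x y)"

lemma cinner_self: "cinner x x = complex_of_real ((norm x)\<^sup>2)"
  for x :: "'a::complex_inner"
proof (rule complex_eqI)
  show "Re (cinner x x) = Re (complex_of_real ((norm x)\<^sup>2))"
    by (simp add: power2_norm_eq_inner inner_eq_Re_cinner)
  have "Im (cinner x x) = - Im (cinner x x)"
    using arg_cong[OF cinner_commute[of x x], of Im] by simp
  then show "Im (cinner x x) = Im (complex_of_real ((norm x)\<^sup>2))"
    by simp
qed

class chilbert_space = complex_inner + complete_space

instantiation complex :: chilbert_space
begin

definition scaleC_complex :: "complex \<Rightarrow> complex \<Rightarrow> complex"
  where "scaleC_complex c x = c * x"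

definition cinner_complex :: "complex \<Rightarrow> complex \<Rightarrow> complex"
  where "cinner_complex x y = x * cnj y"

instance
  by standard
    (simp_all add: scaleC_complex_def cinner_complex_def inner_complex_def scaleR_conv_of_real
      algebra_simps)

end

definition bounded_clinear :: "('a::complex_inner \<Rightarrow> 'b::complex_inner) \<Rightarrow> bool"
  where "bounded_clinear T \<longleftrightarrow> bounded_linear T \<and> (\<forall>c x. T (c *\<^sub>C x) = c *\<^sub>C T x)"

definition positive_op :: "('a::complex_inner \<Rightarrow> 'a) \<Rightarrow> bool"
  where "positive_op A \<longleftrightarrow> (\<forall>x. cinner (A x) x \<in> \<real>\<^sub>\<ge>\<^sub>0)"

definition cadjoint :: "('a::chilbert_space \<Rightarrow> 'a) \<Rightarrow> 'a \<Rightarrow> 'a"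
  where "cadjoint T = (THE S. bounded_clinear S \<and> (\<forall>x y. cinner (T x) y = cinner x (S y)))"

definition semi_inner :: "('a::complex_inner \<Rightarrow> 'a) \<Rightarrow> 'a \<Rightarrow> 'a \<Rightarrow> complex"
  where "semi_inner A x y = cinner (A x) y"

text \<open>For positive \<open>A\<close> the number \<open>semi_inner A x x\<close> is real and nonnegative.\<close>

definition semi_norm :: "('a::complex_inner \<Rightarrow> 'a) \<Rightarrow> 'a \<Rightarrow> real"
  where "semi_norm A x = sqrt (Re (semi_inner A x x))"

definition semi_ops :: "('a::chilbert_space \<Rightarrow> 'a) \<Rightarrow> ('a \<Rightarrow> 'a) set"
  where "semi_ops A = {T. bounded_clinear T \<and> range (cadjoint T \<circ> A) \<subseteq> range A}"

definition semi_adjoint :: "('a::chilbert_space \<Rightarrow> 'a) \<Rightarrow> ('a \<Rightarrow> 'a) \<Rightarrow> 'a \<Rightarrow> 'a"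
  where "semi_adjoint A T =
    (THE X. bounded_clinear X \<and> A \<circ> X = cadjoint T \<circ> A \<and> range X \<subseteq> closure (range A))"

text \<open>
  The suprema below are taken in the reals. For nonzero positive \<open>A\<close> and \<open>T \<in> semi_ops A\<close>
  they range over nonempty bounded sets, since such \<open>T\<close> are bounded for \<open>semi_norm A\<close>.
\<close>

definition semi_opnorm :: "('a::complex_inner \<Rightarrow> 'a) \<Rightarrow> ('a \<Rightarrow> 'a) \<Rightarrow> real"
  where "semi_opnorm A T = (SUP x\<in>{x. semi_norm A x = 1}. semi_norm A (T x))"

definition semi_numerical_radius :: "('a::complex_inner \<Rightarrow> 'a) \<Rightarrow> ('a \<Rightarrow> 'a) \<Rightarrow> real"
  where "semi_numerical_radius A T =
    (SUP x\<in>{x. semi_norm A x = 1}. cmod (semi_inner A (T x) x))"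

definition davis_wielandt_radius :: "('a::complex_inner \<Rightarrow> 'a) \<Rightarrow> ('a \<Rightarrow> 'a) \<Rightarrow> real"
  where "davis_wielandt_radius A T =
    (SUP x\<in>{x. semi_norm A x = 1}.
      sqrt ((cmod (semi_inner A (T x) x))\<^sup>2 + semi_norm A (T x) ^ 4))"

end

theory Submission
  imports Defs
begin

text \<open>
  Write \<open>N\<close> and \<open>w\<close> for the \<open>A\<close>-norm and the \<open>A\<close>-numerical radius of \<open>T\<close>. Each of the four
  statements is equivalent to \<open>w = N\<close>, that is, to the existence of \<open>A\<close>-unit vectors \<open>x\<close> and numbers
  \<open>\<mu>\<close> of modulus \<open>N\<close> with \<open>T x - \<mu> x \<approx> 0\<close> in the seminorm. Let \<open>X\<close> be the \<open>A\<close>-adjoint of \<open>T\<close>.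
  If \<open>|\<langle>T\<^sup>2 x, x\<rangle>| \<approx> N\<^sup>2\<close>, then near equality in the Cauchy-Schwarz inequality gives
  \<open>T\<^sup>2 x \<approx> \<mu>\<^sup>2 x\<close> with \<open>|\<mu>| = N\<close>, and \<open>T\<^sup>2 - \<mu>\<^sup>2 = (T + \<mu>) (T - \<mu>)\<close> produces an approximate eigenvector.
  If \<open>|\<langle>T X T x, x\<rangle>| \<approx> N\<^sup>3\<close>, then \<open>\<parallel>T x\<parallel> \<approx> N\<close>, hence \<open>X T x \<approx> N\<^sup>2 x\<close> and \<open>|\<langle>T x, x\<rangle>| \<approx> N\<close>.
  If \<open>x\<close> nearly attains the Davis-Wielandt bound, it nearly attains both \<open>w\<close> and \<open>N\<close>; then \<open>x\<close> is
  nearly in the kernel of the positive form \<open>2 w - c T - (c T)\<^sup>*\<close> for a suitable unimodular \<open>c\<close>,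
  which turns into a quadratic equation for \<open>X\<close> whose roots have modulus \<open>N\<close>.

  Boundedness of the \<open>A\<close>-adjoint follows from the Baire category theorem, and the \<open>A\<close>-boundedness
  of \<open>T\<close> from the log-convexity of \<open>k \<mapsto> \<parallel>(X T)\<^sup>k x\<parallel>\<close>.
\<close>

subsection \<open>Semi-inner products\<close>

lemma complex_phase:
  obtains c :: complex where "cmod c = 1" "c * z = of_real (cmod z)"
proof (cases "z = 0")
  case True
  then show thesis
    using that[of 1] by simp
next
  case False
  show thesis
  proof (rule that[of "cnj (sgn z)"])
    show "cmod (cnj (sgn z)) = 1"
      using False by (simp add: norm_sgn)
    show "cnj (sgn z) * z = of_real (cmod z)"
      using False complex_norm_square[of z] by (simp add: sgn_eq field_simps power2_eq_square)
  qed
qed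

text \<open>Definiteness is left out because the locale serves the complex inner product, the form
  \<open>semi_inner A\<close>, and the form of the operator \<open>D\<close> in
  \<open>defect_bound\<close>; the last two may vanish on nonzero vectors.\<close>

locale semi_inner_form =
  fixes q :: "'a::complex_vector \<Rightarrow> 'a \<Rightarrow> complex"
  assumes q_commute: "q x y = cnj (q y x)"
    and q_add_left: "q (x + y) z = q x z + q y z"
    and q_scaleC_left: "q (c *\<^sub>C x) y = c * q x y"
    and q_nonneg: "0 \<le> Re (q x x)"
begin

definition s :: "'a \<Rightarrow> real"
  where "s x = sqrt (Re (q x x))"

lemma q_add_right: "q x (y + z) = q x y + q x z"
  using q_add_left[of y z x] by (simp add: q_commute[of x])

lemma q_scaleC_right: "q x (c *\<^sub>C y) = cnj c * q x y"
  using q_scaleC_left[of c y x] by (simp add: q_commute[of x])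

lemma q_diff_left: "q (x - y) z = q x z - q y z"
  using q_add_left[of "x - y" y z] by simp

lemma q_diff_right: "q z (x - y) = q z x - q z y"
  using q_add_right[of z "x - y" y] by simp

lemmas q_simps = q_add_left q_add_right q_scaleC_left q_scaleC_right q_diff_left q_diff_right

lemma s_nonneg [simp]: "0 \<le> s x"
  by (simp add: s_def q_nonneg)

lemma s_squared: "(s x)\<^sup>2 = Re (q x x)"
  by (simp add: s_def q_nonneg)

lemma q_self: "q x x = complex_of_real ((s x)\<^sup>2)"
proof (rule complex_eqI)
  have "Im (q x x) = - Im (q x x)"
    using arg_cong[OF q_commute[of x x], of Im] by simp
  then show "Im (q x x) = Im (complex_of_real ((s x)\<^sup>2))"
    by simp
qed (simp add: s_squared)

lemma s_diff_scaleC_squared: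
  "(s (x - c *\<^sub>C y))\<^sup>2 = (s x)\<^sup>2 - 2 * Re (cnj c * q x y) + (cmod c)\<^sup>2 * (s y)\<^sup>2"
proof -
  have "cnj (cnj c * q x y) = c * q y x"
    using q_commute[of y x] by simp
  then have "Re (c * q y x) = Re (cnj c * q x y)"
    by (metis cnj.sel(1))
  moreover have "Re (c * (cnj c * q y y)) = (cmod c)\<^sup>2 * (s y)\<^sup>2"
    by (simp add: q_self complex_norm_square[symmetric] mult.assoc[symmetric] del: of_real_power)
  ultimately show ?thesis
    by (simp add: s_squared q_simps del: times_complex.simps) (simp add: q_self algebra_simps)
qed

lemma s_scaleC: "s (c *\<^sub>C x) = cmod c * s x"
proof -
  have "q (c *\<^sub>C x) (c *\<^sub>C x) = (c * cnj c) * q x x"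
    by (simp add: q_scaleC_left q_scaleC_right)
  also have "\<dots> = of_real ((cmod c * s x)\<^sup>2)"
    by (simp only: q_self complex_norm_square[symmetric] of_real_mult of_real_power power_mult_distrib)
  finally have "(s (c *\<^sub>C x))\<^sup>2 = (cmod c * s x)\<^sup>2"
    by (metis s_squared Re_complex_of_real)
  then show ?thesis
    by (simp add: power2_eq_iff_nonneg)
qed

lemma cauchy_schwarz: "cmod (q x y) \<le> s x * s y"
proof -
  let ?c = "cmod (q x y)"
  \<comment> \<open>The coefficient \<open>t * q x y\<close> makes the cross term real, so that a
    nonnegative real quadratic in \<open>t\<close> results.\<close>
  have key: "0 \<le> (s x)\<^sup>2 - 2 * t * ?c\<^sup>2 + t\<^sup>2 * ?c\<^sup>2 * (s y)\<^sup>2" for t :: real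
  proof -
    have "0 \<le> (s (x - (of_real t * q x y) *\<^sub>C y))\<^sup>2"
      by simp
    also have "\<dots> = (s x)\<^sup>2 - 2 * t * ?c\<^sup>2 + t\<^sup>2 * ?c\<^sup>2 * (s y)\<^sup>2"
    proof -
      have "cnj (of_real t * q x y) * q x y = of_real (t * ?c\<^sup>2)"
        using complex_norm_square[of "q x y"] by (simp add: algebra_simps)
      then have "Re (cnj (of_real t * q x y) * q x y) = t * ?c\<^sup>2"
        by (metis Re_complex_of_real)
      then show ?thesis
        by (simp only: s_diff_scaleC_squared) (simp add: norm_mult power_mult_distrib)
    qed
    finally show ?thesis .
  qed
  show ?thesis
  proof (cases "s y = 0")
    case True
    have "?c = 0"
    proof (rule ccontr)
      assume c: "?c \<noteq> 0"
      \<comment> \<open>With \<open>s y = 0\<close> the quadratic is affine in \<open>t\<close>;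
        this \<open>t\<close> gives it the value -1.\<close>
      have "2 * (((s x)\<^sup>2 + 1) / (2 * ?c\<^sup>2)) * ?c\<^sup>2 = (s x)\<^sup>2 + 1"
        using c by (simp add: field_simps)
      with key[of "((s x)\<^sup>2 + 1) / (2 * ?c\<^sup>2)"] True show False
        by simp
    qed
    with True show ?thesis by simp
  next
    case False
    \<comment> \<open>The value \<open>1 / (s y)\<^sup>2\<close> of \<open>t\<close> minimises the
      quadratic.\<close>
    have "2 * (1 / (s y)\<^sup>2) * ?c\<^sup>2 = 2 * (?c\<^sup>2 / (s y)\<^sup>2)"
      "(1 / (s y)\<^sup>2)\<^sup>2 * ?c\<^sup>2 * (s y)\<^sup>2 = ?c\<^sup>2 / (s y)\<^sup>2"
      using False by (simp_all add: field_simps power2_eq_square)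
    with key[of "1 / (s y)\<^sup>2"] have "?c\<^sup>2 / (s y)\<^sup>2 \<le> (s x)\<^sup>2"
      by simp
    then have "?c\<^sup>2 \<le> (s x * s y)\<^sup>2"
      using False by (simp add: field_simps power_mult_distrib)
    then show ?thesis
      by (simp add: power2_le_iff_abs_le)
  qed
qed

lemma s_triangle: "s (x + y) \<le> s x + s y"
proof -
  have "(s (x + y))\<^sup>2 = (s x)\<^sup>2 + 2 * Re (q x y) + (s y)\<^sup>2"
    using arg_cong[OF q_commute[of y x], of Re] by (simp add: s_squared q_simps)
  also have "Re (q x y) \<le> s x * s y"
    using cauchy_schwarz[of x y] complex_Re_le_cmod[of "q x y"] by linarith
  finally have "(s (x + y))\<^sup>2 \<le> (s x + s y)\<^sup>2"
    by (simp add: power2_sum)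
  then show ?thesis
    by (simp add: power2_le_iff_abs_le)
qed

lemma s_uminus: "s (- x) = s x"
  using s_scaleC[of "-1" x] scaleR_scaleC[of "-1" x] by simp

lemma s_triangle_diff: "s (x - y) \<le> s x + s y"
  using s_triangle[of x "- y"] by (simp add: s_uminus)

lemma s_tendsto_zero_le:
  assumes "(\<lambda>n. s (x n)) \<longlonglongrightarrow> 0" "\<And>n. s (y n) \<le> K * s (x n)"
  shows "(\<lambda>n. s (y n)) \<longlonglongrightarrow> 0"
  by (rule tendsto_sandwich[of "\<lambda>_. 0" _ _ "\<lambda>n. K * s (x n)"])
     (use tendsto_mult[OF tendsto_const[of K] assms(1)] assms(2) in auto)

lemma tendsto_zero_if_s_power:
  assumes "(\<lambda>n. (s (x n))\<^sup>2) \<longlonglongrightarrow> 0"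
  shows "(\<lambda>n. s (x n)) \<longlonglongrightarrow> 0"
  using tendsto_real_sqrt[OF assms] by simp

text \<open>Near equality in the Cauchy-Schwarz inequality forces near alignment.\<close>

lemma aligned_of_inner_tendsto:
  assumes unit: "\<And>n. s (x n) = 1" and bd: "\<And>n. s (u n) \<le> M"
    and lim: "(\<lambda>n. cmod (q (u n) (x n))) \<longlonglongrightarrow> M"
  obtains c :: "nat \<Rightarrow> complex" where "\<And>n. cmod (c n) = 1"
    "(\<lambda>n. s (u n - (of_real M * c n) *\<^sub>C x n)) \<longlonglongrightarrow> 0"
proof -
  have "\<exists>c. cmod c = 1 \<and> cnj c * q (u n) (x n) = of_real (cmod (q (u n) (x n)))" for n
    by (rule complex_phase[of "q (u n) (x n)"]) (metis complex_cnj_cnj complex_mod_cnj)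
  then obtain c where c1: "\<And>n. cmod (c n) = 1"
    and cq: "\<And>n. cnj (c n) * q (u n) (x n) = of_real (cmod (q (u n) (x n)))"
    by metis
  have M0: "0 \<le> M"
    using bd[of 0] s_nonneg[of "u 0"] by linarith
  have eq: "(s (u n - (of_real M * c n) *\<^sub>C x n))\<^sup>2 = (s (u n))\<^sup>2 - 2 * M * cmod (q (u n) (x n)) + M\<^sup>2"
    for n
  proof -
    have "cnj (of_real M * c n) * q (u n) (x n) = of_real (M * cmod (q (u n) (x n)))"
      using cq[of n] by (simp add: mult.assoc)
    then have "Re (cnj (of_real M * c n) * q (u n) (x n)) = M * cmod (q (u n) (x n))"
      by (metis Re_complex_of_real)
    then show ?thesis
      using M0 by (simp only: s_diff_scaleC_squared) (simp add: norm_mult c1 unit)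
  qed
  have "(\<lambda>n. (s (u n - (of_real M * c n) *\<^sub>C x n))\<^sup>2) \<longlonglongrightarrow> 0"
  proof (rule tendsto_sandwich[of "\<lambda>_. 0" _ _ "\<lambda>n. 2 * M\<^sup>2 - 2 * M * cmod (q (u n) (x n))"])
    have "(\<lambda>n. 2 * M\<^sup>2 - 2 * M * cmod (q (u n) (x n))) \<longlonglongrightarrow> 2 * M\<^sup>2 - 2 * M * M"
      by (intro tendsto_intros lim)
    then show "(\<lambda>n. 2 * M\<^sup>2 - 2 * M * cmod (q (u n) (x n))) \<longlonglongrightarrow> 0"
      by (simp add: power2_eq_square)
    have "(s (u n))\<^sup>2 \<le> M\<^sup>2" for n
      using bd by (simp add: power_mono)
    then show "\<forall>\<^sub>F n in sequentially. (s (u n - (of_real M * c n) *\<^sub>C x n))\<^sup>2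
        \<le> 2 * M\<^sup>2 - 2 * M * cmod (q (u n) (x n))"
      by (simp add: eq)
  qed auto
  then show thesis
    by (rule that[OF c1 tendsto_zero_if_s_power])
qed

text \<open>Converse of \<open>aligned_of_inner_tendsto\<close>: by Cauchy-Schwarz with a unit
  vector, replacing \<open>u n\<close> by \<open>c n *\<^sub>C x n\<close> changes the inner product
  by at most the seminorm of their difference.\<close>

lemma inner_tendsto_of_aligned:
  assumes unit: "\<And>n. s (x n) = 1" and M: "0 \<le> M" and c: "\<And>n. cmod (c n) = M"
    and lim: "(\<lambda>n. s (u n - c n *\<^sub>C x n)) \<longlonglongrightarrow> 0"
  shows "(\<lambda>n. cmod (q (u n) (x n))) \<longlonglongrightarrow> M"
proof (rule LIM_zero_cancel, rule tendsto_rabs_zero_cancel,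
    rule tendsto_sandwich[of "\<lambda>_. 0" _ _ "\<lambda>n. s (u n - c n *\<^sub>C x n)"])
  have "\<bar>cmod (q (u n) (x n)) - M\<bar> \<le> s (u n - c n *\<^sub>C x n)" for n
  proof -
    have "\<bar>cmod (q (u n) (x n)) - cmod (c n)\<bar> \<le> cmod (q (u n) (x n) - c n)"
      by (rule norm_triangle_ineq3)
    also have "q (u n) (x n) - c n = q (u n - c n *\<^sub>C x n) (x n)"
      by (simp add: q_simps q_self unit)
    also have "cmod \<dots> \<le> s (u n - c n *\<^sub>C x n)"
      using cauchy_schwarz[of _ "x n"] unit by (metis mult.right_neutral)
    finally show ?thesis by (simp add: c)
  qed
  then show "\<forall>\<^sub>F n in sequentially. \<bar>cmod (q (u n) (x n)) - M\<bar> \<le> s (u n - c n *\<^sub>C x n)"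
    by simp
qed (use lim in auto)

section \<open>Normalisation, and suprema over unit vectors as limits\<close>

lemma exists_unit:
  assumes "s x \<noteq> 0"
  shows "\<exists>x. s x = 1"
proof
  show "s (complex_of_real (1 / s x) *\<^sub>C x) = 1"
    using assms by (simp add: s_scaleC norm_divide)
qed

text \<open>Homogeneity carries the bound over from unit vectors. Null vectors cannot be normalised
  and are covered by \<open>zero\<close>. The degree \<open>p\<close> is 1 for the operator norm and
  2 for the numerical radius.\<close>

lemma bound_of_unit_bound:
  assumes unit: "\<And>x. s x = 1 \<Longrightarrow> f x \<le> K" and zero: "\<And>x. s x = 0 \<Longrightarrow> f x \<le> 0"
    and f: "\<And>c x. f (c *\<^sub>C x) = cmod c ^ p * f x" and p: "0 < p"
  shows "f x \<le> K * s x ^ p"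
proof (cases "s x = 0")
  case False
  then have pos: "0 < s x"
    using s_nonneg[of x] by linarith
  have "f (complex_of_real (1 / s x) *\<^sub>C x) \<le> K"
    using False by (intro unit) (simp add: s_scaleC norm_divide)
  then show ?thesis
    using pos by (simp only: f) (simp add: norm_divide power_one_over field_simps)
qed (use zero p in \<open>simp add: zero_power\<close>)

text \<open>Common form in which the conditions are compared: the statements about sequences have it
  literally, the equalities of suprema by \<open>SUP_eq_iff_approached\<close>.\<close>

definition approached :: "('a \<Rightarrow> real) \<Rightarrow> real \<Rightarrow> bool"
  where "approached f M \<longleftrightarrow> (\<exists>x :: nat \<Rightarrow> 'a. (\<forall>n. s (x n) = 1) \<and> (\<lambda>n. f (x n)) \<longlonglongrightarrow> M)"

lemma approachedI_eps:
  assumes bd: "\<And>x. s x = 1 \<Longrightarrow> f x \<le> M"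
    and ex: "\<And>e. e > 0 \<Longrightarrow> \<exists>x. s x = 1 \<and> f x > M - e"
  shows "approached f M"
proof -
  have "\<exists>x. s x = 1 \<and> f x > M - inverse (real (Suc n))" for n
    by (rule ex) simp
  then obtain x where x: "\<And>n. s (x n) = 1" "\<And>n. f (x n) > M - inverse (real (Suc n))"
    by metis
  have "(\<lambda>n. f (x n)) \<longlonglongrightarrow> M"
  proof (rule tendsto_sandwich[of "\<lambda>n. M - inverse (real (Suc n))" _ _ "\<lambda>_. M"])
    show "(\<lambda>n. M - inverse (real (Suc n))) \<longlonglongrightarrow> M"
      using tendsto_diff[OF tendsto_const[of M] LIMSEQ_inverse_real_of_nat] by simp
  qed (use x bd in \<open>auto intro: less_imp_le always_eventually\<close>)
  with x show ?thesis
    unfolding approached_def by blast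
qed

lemma SUP_eq_iff_approached:
  assumes ne: "\<exists>x. s x = 1" and bd: "\<And>x. s x = 1 \<Longrightarrow> f x \<le> M"
  shows "(SUP x\<in>{x. s x = 1}. f x) = M \<longleftrightarrow> approached f M"
proof
  have bdd: "bdd_above (f ` {x. s x = 1})"
    using bd by (intro bdd_aboveI2[of _ _ M]) auto
  assume sup: "(SUP x\<in>{x. s x = 1}. f x) = M"
  show "approached f M"
  proof (rule approachedI_eps)
    fix e :: real assume "e > 0"
    then have "M - e < (SUP x\<in>{x. s x = 1}. f x)"
      using sup by simp
    then show "\<exists>x. s x = 1 \<and> M - e < f x"
      using less_cSUP_iff[of "{x. s x = 1}" f "M - e"] ne bdd by auto
  qed (rule bd)
next
  have bdd: "bdd_above (f ` {x. s x = 1})"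
    using bd by (intro bdd_aboveI2[of _ _ M]) auto
  assume "approached f M"
  then obtain x :: "nat \<Rightarrow> 'a" where x: "\<And>n. s (x n) = 1" "(\<lambda>n. f (x n)) \<longlonglongrightarrow> M"
    by (auto simp: approached_def)
  have "M \<le> (SUP x\<in>{x. s x = 1}. f x)"
    using x by (intro LIMSEQ_le_const2[OF x(2)]) (auto intro!: cSUP_upper bdd exI[of _ 0])
  moreover have "(SUP x\<in>{x. s x = 1}. f x) \<le> M"
    using ne bd by (intro cSUP_least) auto
  ultimately show "(SUP x\<in>{x. s x = 1}. f x) = M"
    by simp
qed

end

subsection \<open>Operators with an adjoint for a semi-inner product\<close>

interpretation complex_vector: module "scaleC :: complex \<Rightarrow> 'a \<Rightarrow> 'a::complex_vector"
  by unfold_locales (simp_all add: scaleC_add_right scaleC_add_left scaleC_scaleC scaleC_one)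

lemmas scaleC_expand =
  complex_vector.scale_right_diff_distrib complex_vector.scale_left_diff_distrib
  scaleC_add_right scaleC_add_left

context semi_inner_form
begin

lemma cmod_inner_ge_of_aligned:
  assumes "s x = 1" "s (y - c *\<^sub>C x) < e"
  shows "cmod c - e < cmod (q y x)"
proof -
  have "cmod c - cmod (q y x) \<le> cmod (c - q y x)"
    by (rule norm_triangle_ineq2)
  also have "\<dots> = cmod (q (y - c *\<^sub>C x) x)"
    using assms(1) by (simp add: q_simps q_self norm_minus_commute)
  also have "\<dots> \<le> s (y - c *\<^sub>C x)"
    using cauchy_schwarz[of "y - c *\<^sub>C x" x] assms(1) by simp
  finally show ?thesis
    using assms(2) by linarith
qed

text \<open>The hypothesis \<open>lim\<close> says that \<open>(Y - l n) (Y - k n) x n\<close> tends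
  to zero. Either \<open>u n\<close> is small and \<open>x n\<close> is an approximate eigenvector
  for \<open>k n\<close>, or the normalised \<open>u n\<close> is one for \<open>l n\<close>. Both
  numbers have modulus \<open>N\<close>, so either case yields a numerical value close to
  \<open>N\<close>.\<close>

lemma approached_of_quadratic_factor:
  assumes unit: "\<And>n. s (x n) = 1" and bd: "\<And>x. s x = 1 \<Longrightarrow> cmod (q (Y x) x) \<le> N"
    and Y_scaleC: "\<And>c x. Y (c *\<^sub>C x) = c *\<^sub>C Y x"
    and k: "\<And>n. cmod (k n) = N" and l: "\<And>n. cmod (l n) = N"
    and u: "\<And>n. u n = Y (x n) - k n *\<^sub>C x n"
    and lim: "(\<lambda>n. s (Y (u n) - l n *\<^sub>C u n)) \<longlonglongrightarrow> 0"
  shows "approached (\<lambda>x. cmod (q (Y x) x)) N"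
proof (rule approachedI_eps)
  fix e :: real assume e: "e > 0"
  \<comment> \<open>The tolerance is squared because the second case divides by
    \<open>s (u n)\<close>, which is only known to be at least \<open>e\<close>.\<close>
  then have "e\<^sup>2 > 0" by simp
  with lim have "\<forall>\<^sub>F n in sequentially. s (Y (u n) - l n *\<^sub>C u n) < e\<^sup>2"
    by (rule order_tendstoD)
  then obtain n where n: "s (Y (u n) - l n *\<^sub>C u n) < e\<^sup>2"
    by (auto simp: eventually_sequentially)
  show "\<exists>x. s x = 1 \<and> cmod (q (Y x) x) > N - e"
  proof (cases "s (u n) < e")
    case True
    then show ?thesis
      using cmod_inner_ge_of_aligned[of "x n" "Y (x n)" "k n" e] unit k u by (intro exI[of _ "x n"]) simp
  next
    case False
    define z where "z = complex_of_real (1 / s (u n)) *\<^sub>C u n"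
    have z: "s z = 1"
      using False e by (simp add: z_def s_scaleC norm_divide)
    have "Y z - l n *\<^sub>C z = complex_of_real (1 / s (u n)) *\<^sub>C (Y (u n) - l n *\<^sub>C u n)"
      by (simp add: z_def Y_scaleC complex_vector.scale_right_diff_distrib mult.commute)
    then have "s (Y z - l n *\<^sub>C z) = s (Y (u n) - l n *\<^sub>C u n) / s (u n)"
      by (simp add: s_scaleC norm_divide)
    also have "\<dots> < e"
    proof -
      have "e\<^sup>2 \<le> e * s (u n)"
        using False e by (simp add: power2_eq_square)
      with n have "s (Y (u n) - l n *\<^sub>C u n) < e * s (u n)"
        by linarith
      then show ?thesis
        using False e by (simp add: divide_less_eq)
    qed
    finally show ?thesis
      using cmod_inner_ge_of_aligned[of z "Y z" "l n" e] z l by auto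
  qed
qed (rule bd)

end

text \<open>Here \<open>N\<close> is any bound for \<open>T\<close>. The locale is entered first
  with some constant, which makes the suprema finite, and then with the operator norm.\<close>

locale semi_adjoint_pair = semi_inner_form q
  for q :: "'a::complex_vector \<Rightarrow> 'a \<Rightarrow> complex" +
  fixes T X :: "'a \<Rightarrow> 'a" and N :: real
  assumes T_add: "T (x + y) = T x + T y" and T_scaleC: "T (c *\<^sub>C x) = c *\<^sub>C T x"
    and X_add: "X (x + y) = X x + X y" and X_scaleC: "X (c *\<^sub>C x) = c *\<^sub>C X x"
    and adjoint: "q (T x) y = q x (X y)"
    and N_nonneg: "0 \<le> N" and T_bound: "s (T x) \<le> N * s x"
begin

section \<open>Approximate eigenvectors of an operator and its adjoint\<close>

lemma adjoint': "q (X x) y = q x (T y)"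
  using adjoint[of y x] by (metis q_commute)

lemma X_bound: "s (X x) \<le> N * s x"
proof (cases "s (X x) = 0")
  case False
  have "(s (X x))\<^sup>2 = Re (q (T (X x)) x)"
    by (simp add: s_squared adjoint)
  also have "\<dots> \<le> s (T (X x)) * s x"
    using cauchy_schwarz[of "T (X x)" x] complex_Re_le_cmod[of "q (T (X x)) x"] by linarith
  also have "\<dots> \<le> N * s (X x) * s x"
    by (intro mult_right_mono T_bound) simp
  finally have "s (X x) * s (X x) \<le> (N * s x) * s (X x)"
    by (simp add: power2_eq_square mult_ac)
  then show ?thesis
    using False s_nonneg[of "X x"] by (simp add: mult_le_cancel_right)
qed (simp add: N_nonneg)

lemma T_diff: "T (x - y) = T x - T y" and X_diff: "X (x - y) = X x - X y"
  using T_add[of "x - y" y] X_add[of "x - y" y] by simp_all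

lemma numerical_le: "cmod (q (T x) x) \<le> N * (s x)\<^sup>2"
  using order_trans[OF cauchy_schwarz[of "T x" x] mult_right_mono[OF T_bound[of x] s_nonneg[of x]]]
  by (simp add: power2_eq_square mult_ac)

lemma numerical_X: "cmod (q (X x) x) = cmod (q (T x) x)"
  using adjoint'[of x x] q_commute[of x "T x"] by simp

text \<open>The cross term is governed by \<open>q (X (T x)) x = (s (T x))\<^sup>2\<close>, and
  \<open>X_bound\<close> controls \<open>X (T x)\<close>. The expanded square is then at most
  \<open>N ^ 4 - N\<^sup>2 * (s (T x))\<^sup>2\<close>.\<close>

lemma XT_aligned:
  assumes unit: "\<And>n. s (x n) = 1" and lim: "(\<lambda>n. s (T (x n))) \<longlonglongrightarrow> N"
  shows "(\<lambda>n. s (X (T (x n)) - of_real (N\<^sup>2) *\<^sub>C x n)) \<longlonglongrightarrow> 0"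
proof (rule tendsto_zero_if_s_power)
  have "(s (X (T (x n)) - of_real (N\<^sup>2) *\<^sub>C x n))\<^sup>2 \<le> N ^ 4 - N\<^sup>2 * (s (T (x n)))\<^sup>2" for n
  proof -
    have "q (X (T (x n))) (x n) = of_real ((s (T (x n)))\<^sup>2)"
      by (simp only: adjoint' q_self)
    then have "Re (cnj (of_real (N\<^sup>2)) * q (X (T (x n))) (x n)) = N\<^sup>2 * (s (T (x n)))\<^sup>2"
      by (simp del: of_real_power)
    moreover have "(s (X (T (x n))))\<^sup>2 \<le> (N * s (T (x n)))\<^sup>2"
      by (intro power_mono X_bound) simp
    ultimately show ?thesis
      by (simp only: s_diff_scaleC_squared unit)
         (simp add: power_mult_distrib del: of_real_power)
  qed
  note le = this
  have "(\<lambda>n. N ^ 4 - N\<^sup>2 * (s (T (x n)))\<^sup>2) \<longlonglongrightarrow> N ^ 4 - N\<^sup>2 * N\<^sup>2"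
    by (intro tendsto_intros lim)
  also have "N ^ 4 - N\<^sup>2 * N\<^sup>2 = 0"
    by (simp add: power2_eq_square power4_eq_xxxx)
  finally have "(\<lambda>n. N ^ 4 - N\<^sup>2 * (s (T (x n)))\<^sup>2) \<longlonglongrightarrow> 0" .
  then show "(\<lambda>n. (s (X (T (x n)) - of_real (N\<^sup>2) *\<^sub>C x n))\<^sup>2) \<longlonglongrightarrow> 0"
    by (rule tendsto_sandwich[rotated -1, of _ _ _ "\<lambda>_. 0"])
       (intro always_eventually allI le zero_le_power2 tendsto_const)+
qed

text \<open>By \<open>XT_aligned\<close>, the inner vector \<open>X (T (x n))\<close> may be
  replaced by \<open>of_real (N\<^sup>2) *\<^sub>C x n\<close>; applying \<open>T\<close> enlarges
  the error by a factor of at most \<open>N\<close>.\<close>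

lemma TXT_numerical_diff:
  assumes unit: "\<And>n. s (x n) = 1" and lim: "(\<lambda>n. s (T (x n))) \<longlonglongrightarrow> N"
  shows "(\<lambda>n. cmod (q (T (X (T (x n)))) (x n)) - N\<^sup>2 * cmod (q (T (x n)) (x n))) \<longlonglongrightarrow> 0"
proof (rule tendsto_rabs_zero_cancel, rule tendsto_sandwich[of "\<lambda>_. 0"])
  let ?d = "\<lambda>n. X (T (x n)) - of_real (N\<^sup>2) *\<^sub>C x n"
  have "\<bar>cmod (q (T (X (T (x n)))) (x n)) - N\<^sup>2 * cmod (q (T (x n)) (x n))\<bar> \<le> N * s (?d n)" for n
  proof -
    have "\<bar>cmod (q (T (X (T (x n)))) (x n)) - cmod (of_real (N\<^sup>2) * q (T (x n)) (x n))\<bar>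
        \<le> cmod (q (T (X (T (x n)))) (x n) - of_real (N\<^sup>2) * q (T (x n)) (x n))"
      by (rule norm_triangle_ineq3)
    also have "\<dots> = cmod (q (T (?d n)) (x n))"
      by (simp only: T_diff T_scaleC q_diff_left q_scaleC_left)
    also have "\<dots> \<le> s (T (?d n))"
      using cauchy_schwarz[of "T (?d n)" "x n"] unit by simp
    also have "\<dots> \<le> N * s (?d n)"
      by (rule T_bound)
    finally show ?thesis
      by (simp add: norm_mult norm_power)
  qed
  then show "\<forall>\<^sub>F n in sequentially.
      \<bar>cmod (q (T (X (T (x n)))) (x n)) - N\<^sup>2 * cmod (q (T (x n)) (x n))\<bar> \<le> N * s (?d n)"
    by simp
  show "(\<lambda>n. N * s (?d n)) \<longlonglongrightarrow> 0"
    using tendsto_mult[OF tendsto_const[of N] XT_aligned[OF assms]] by simp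
qed auto

lemma norm_tendsto_of_numerical:
  assumes unit: "\<And>n. s (x n) = 1" and lim: "(\<lambda>n. cmod (q (T (x n)) (x n))) \<longlonglongrightarrow> N"
  shows "(\<lambda>n. s (T (x n))) \<longlonglongrightarrow> N"
proof (rule tendsto_sandwich[OF _ _ lim tendsto_const[of N]])
  show "\<forall>\<^sub>F n in sequentially. cmod (q (T (x n)) (x n)) \<le> s (T (x n))"
    using cauchy_schwarz[of "T (x _)" "x _"] unit by (intro always_eventually allI) (metis mult.right_neutral)
  show "\<forall>\<^sub>F n in sequentially. s (T (x n)) \<le> N"
    using T_bound[of "x _"] unit by (intro always_eventually allI) (metis mult.right_neutral)
qed

lemma approached_square_iff:
  "approached (\<lambda>x. cmod (q (T (T x)) x)) (N\<^sup>2) \<longleftrightarrow> approached (\<lambda>x. cmod (q (T x) x)) N"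
proof
  assume "approached (\<lambda>x. cmod (q (T (T x)) x)) (N\<^sup>2)"
  then obtain x :: "nat \<Rightarrow> 'a" where unit: "\<And>n. s (x n) = 1"
    and lim: "(\<lambda>n. cmod (q (T (T (x n))) (x n))) \<longlonglongrightarrow> N\<^sup>2"
    by (auto simp: approached_def)
  have "s (T (T (x n))) \<le> N\<^sup>2" for n
    using order_trans[OF T_bound mult_left_mono[OF T_bound[of "x n"] N_nonneg]]
    by (simp add: unit power2_eq_square)
  from aligned_of_inner_tendsto[OF unit this lim]
  obtain c where c: "\<And>n. cmod (c n) = 1"
    "(\<lambda>n. s (T (T (x n)) - (of_real (N\<^sup>2) * c n) *\<^sub>C x n)) \<longlonglongrightarrow> 0"
    by blast
  \<comment> \<open>A square root of the approximate eigenvalue of \<open>T\<^sup>2\<close>, so that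
    \<open>T\<^sup>2 - k\<^sup>2\<close> factors as \<open>(T + k) (T - k)\<close>.\<close>
  define k where "k n = of_real N * csqrt (c n)" for n
  have kk: "k n * k n = of_real (N\<^sup>2) * c n" for n
    using power2_csqrt[of "c n"] by (simp add: k_def power2_eq_square algebra_simps)
  have k: "cmod (k n) = N" for n
    by (simp add: k_def norm_mult c N_nonneg)
  have eq: "T (T (x n) - k n *\<^sub>C x n) - (- k n) *\<^sub>C (T (x n) - k n *\<^sub>C x n)
      = T (T (x n)) - (of_real (N\<^sup>2) * c n) *\<^sub>C x n" for n
    by (simp add: T_diff T_scaleC scaleC_expand kk[symmetric] del: of_real_power)
  show "approached (\<lambda>x. cmod (q (T x) x)) N"
  proof (rule approached_of_quadratic_factor[OF unit _ T_scaleC])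
    show "(\<lambda>n. s (T (T (x n) - k n *\<^sub>C x n) - (- k n) *\<^sub>C (T (x n) - k n *\<^sub>C x n))) \<longlonglongrightarrow> 0"
      unfolding eq by (rule c(2))
    show "cmod (q (T x) x) \<le> N" if "s x = 1" for x
      using numerical_le[of x] that by simp
  qed (simp_all add: k)
next
  assume "approached (\<lambda>x. cmod (q (T x) x)) N"
  then obtain x :: "nat \<Rightarrow> 'a" where unit: "\<And>n. s (x n) = 1"
    and lim: "(\<lambda>n. cmod (q (T (x n)) (x n))) \<longlonglongrightarrow> N"
    by (auto simp: approached_def)
  have "s (T (x n)) \<le> N" for n
    using T_bound[of "x n"] unit by simp
  from aligned_of_inner_tendsto[OF unit this lim]
  obtain c where c: "\<And>n. cmod (c n) = 1"
    "(\<lambda>n. s (T (x n) - (of_real N * c n) *\<^sub>C x n)) \<longlonglongrightarrow> 0"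
    by blast
  define m where "m n = of_real N * c n" for n
  let ?u = "\<lambda>n. T (x n) - m n *\<^sub>C x n"
  have m: "cmod (m n) = N" for n
    by (simp add: m_def norm_mult c N_nonneg)
  \<comment> \<open>The factor \<open>T + m\<close> of \<open>T\<^sup>2 - m\<^sup>2\<close> enlarges
    the seminorm by at most \<open>2 * N\<close>.\<close>
  have "s (T (T (x n)) - (m n * m n) *\<^sub>C x n) \<le> (2 * N) * s (?u n)" for n
  proof -
    have "T (T (x n)) - (m n * m n) *\<^sub>C x n = T (?u n) + m n *\<^sub>C ?u n"
      by (simp add: T_diff T_scaleC scaleC_expand)
    then show ?thesis
      using s_triangle[of "T (?u n)" "m n *\<^sub>C ?u n"] T_bound[of "?u n"]
      by (simp add: s_scaleC m)
  qed
  then have "(\<lambda>n. s (T (T (x n)) - (m n * m n) *\<^sub>C x n)) \<longlonglongrightarrow> 0"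
    by (rule s_tendsto_zero_le[rotated]) (use c(2) in \<open>simp add: m_def\<close>)
  then have "(\<lambda>n. cmod (q (T (T (x n))) (x n))) \<longlonglongrightarrow> N\<^sup>2"
    by (rule inner_tendsto_of_aligned[OF unit, rotated 2]) (simp_all add: norm_mult m power2_eq_square)
  with unit show "approached (\<lambda>x. cmod (q (T (T x)) x)) (N\<^sup>2)"
    unfolding approached_def by blast
qed

lemma approached_TXT_iff:
  "approached (\<lambda>x. cmod (q (T (X (T x))) x)) (N ^ 3) \<longleftrightarrow> approached (\<lambda>x. cmod (q (T x) x)) N"
proof
  assume "approached (\<lambda>x. cmod (q (T (X (T x))) x)) (N ^ 3)"
  then obtain x :: "nat \<Rightarrow> 'a" where unit: "\<And>n. s (x n) = 1"
    and lim: "(\<lambda>n. cmod (q (T (X (T (x n)))) (x n))) \<longlonglongrightarrow> N ^ 3"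
    by (auto simp: approached_def)
  have "(\<lambda>n. cmod (q (T (x n)) (x n))) \<longlonglongrightarrow> N"
  \<comment> \<open>The main case divides by \<open>N\<^sup>2\<close>.\<close>
  proof (cases "N = 0")
    case True
    then show ?thesis
      using numerical_le by simp
  next
    case False
    have sT: "(\<lambda>n. s (T (x n))) \<longlonglongrightarrow> N"
    proof (rule tendsto_sandwich[of "\<lambda>n. cmod (q (T (X (T (x n)))) (x n)) / N\<^sup>2" _ _ "\<lambda>_. N"])
      have "(\<lambda>n. cmod (q (T (X (T (x n)))) (x n)) / N\<^sup>2) \<longlonglongrightarrow> N ^ 3 / N\<^sup>2"
        using False by (intro tendsto_intros lim) simp
      then show "(\<lambda>n. cmod (q (T (X (T (x n)))) (x n)) / N\<^sup>2) \<longlonglongrightarrow> N"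
        using False by (simp add: power3_eq_cube power2_eq_square)
      have "cmod (q (T (X (T (x n)))) (x n)) / N\<^sup>2 \<le> s (T (x n))" for n
      proof -
        \<comment> \<open>Moving the outer \<open>T\<close> to the right as \<open>X\<close> lets
          \<open>X_bound\<close> act on both arguments and leaves one factor
          \<open>s (T (x n))\<close>, which is thereby forced up to \<open>N\<close>.\<close>
        have "cmod (q (T (X (T (x n)))) (x n)) \<le> s (X (T (x n))) * s (X (x n))"
          unfolding adjoint[of "X _"] by (rule cauchy_schwarz)
        also have "\<dots> \<le> (N * s (T (x n))) * (N * s (x n))"
          by (intro mult_mono X_bound) (simp_all add: N_nonneg)
        finally show ?thesis
          using False N_nonneg by (simp add: unit pos_divide_le_eq power2_eq_square mult_ac)
      qed
      then show "\<forall>\<^sub>F n in sequentially. cmod (q (T (X (T (x n)))) (x n)) / N\<^sup>2 \<le> s (T (x n))"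
        by simp
      show "\<forall>\<^sub>F n in sequentially. s (T (x n)) \<le> N"
        using T_bound[of "x _"] unit by (intro always_eventually allI) (metis mult.right_neutral)
    qed simp
    have "(\<lambda>n. (cmod (q (T (X (T (x n)))) (x n))
        - (cmod (q (T (X (T (x n)))) (x n)) - N\<^sup>2 * cmod (q (T (x n)) (x n)))) / N\<^sup>2)
      \<longlonglongrightarrow> (N ^ 3 - 0) / N\<^sup>2"
      using False by (intro tendsto_intros lim TXT_numerical_diff[OF unit sT]) simp
    then show ?thesis
      using False by (simp add: power3_eq_cube power2_eq_square)
  qed
  with unit show "approached (\<lambda>x. cmod (q (T x) x)) N"
    unfolding approached_def by blast
next
  assume "approached (\<lambda>x. cmod (q (T x) x)) N"
  then obtain x :: "nat \<Rightarrow> 'a" where unit: "\<And>n. s (x n) = 1"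
    and lim: "(\<lambda>n. cmod (q (T (x n)) (x n))) \<longlonglongrightarrow> N"
    by (auto simp: approached_def)
  have "(\<lambda>n. (cmod (q (T (X (T (x n)))) (x n)) - N\<^sup>2 * cmod (q (T (x n)) (x n)))
      + N\<^sup>2 * cmod (q (T (x n)) (x n))) \<longlonglongrightarrow> 0 + N\<^sup>2 * N"
    by (intro tendsto_intros lim TXT_numerical_diff[OF unit] norm_tendsto_of_numerical[OF unit])
  then have "(\<lambda>n. cmod (q (T (X (T (x n)))) (x n))) \<longlonglongrightarrow> N ^ 3"
    by (simp add: power3_eq_cube power2_eq_square)
  with unit show "approached (\<lambda>x. cmod (q (T (X (T x))) x)) (N ^ 3)"
    unfolding approached_def by blast
qed

text \<open>The operator \<open>D\<close> is positive for \<open>q\<close>, since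
  \<open>Re (c * q (T x) x)\<close> is at most \<open>w * (s x)\<^sup>2\<close>. Cauchy-Schwarz for
  the form \<open>q (D y) z\<close> at \<open>x\<close> and \<open>D x\<close>, together with the
  bound \<open>4 * N\<close> for \<open>D\<close>, gives \<open>D\<^sup>2 \<le> 4 N D\<close> as
  quadratic forms; the last factor in the conclusion is \<open>q (D x) x\<close>.\<close>

lemma defect_bound:
  assumes w: "\<And>x. cmod (q (T x) x) \<le> w * (s x)\<^sup>2" and wN: "w \<le> N" and w0: "0 \<le> w"
    and c: "cmod c = 1"
    and D: "\<And>y. D y = of_real (2 * w) *\<^sub>C y - (c *\<^sub>C T y + cnj c *\<^sub>C X y)"
  shows "(s (D x))\<^sup>2 \<le> 4 * N * (2 * w * (s x)\<^sup>2 - 2 * Re (c * q (T x) x))"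
proof -
  have form: "q (D y) z = of_real (2 * w) * q y z - (c * q (T y) z + cnj c * q y (T z))" for y z
    by (simp only: D q_simps adjoint')
  have Re_eq: "Re (cnj c * q y (T y)) = Re (c * q (T y) y)" for y
    by (metis cnj.sel(1) complex_cnj_cnj complex_cnj_mult q_commute)
  have Re_D: "Re (q (D y) y) = 2 * w * (s y)\<^sup>2 - 2 * Re (c * q (T y) y)" for y
    using Re_eq[of y] by (simp only: form q_self) (simp flip: of_real_power)
  interpret p: semi_inner_form "\<lambda>y z. q (D y) z"
  proof
    fix x y z :: 'a and a :: complex
    show "q (D x) y = cnj (q (D y) x)"
      unfolding form using q_commute[of x y] q_commute[of "T x" y] q_commute[of x "T y"] by simp
    show "q (D (x + y)) z = q (D x) z + q (D y) z"
      by (simp add: form q_add_left T_add algebra_simps)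
    show "q (D (a *\<^sub>C x)) y = a * q (D x) y"
      by (simp add: form q_scaleC_left T_scaleC algebra_simps)
    have "Re (c * q (T x) x) \<le> w * (s x)\<^sup>2"
      using complex_Re_le_cmod[of "c * q (T x) x"] w[of x] by (simp add: norm_mult c)
    then show "0 \<le> Re (q (D x) x)"
      by (simp add: Re_D)
  qed
  have sD: "s (D y) \<le> 4 * N * s y" for y
  proof -
    have "s (D y) \<le> s (of_real (2 * w) *\<^sub>C y) + (s (c *\<^sub>C T y) + s (cnj c *\<^sub>C X y))"
      unfolding D by (rule order_trans[OF s_triangle_diff add_left_mono[OF s_triangle]])
    also have "\<dots> = 2 * w * s y + (s (T y) + s (X y))"
      using w0 by (simp only: s_scaleC norm_of_real c complex_mod_cnj abs_of_nonneg mult_1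
          zero_le_mult_iff zero_le_numeral simp_thms)
    also have "\<dots> \<le> 2 * N * s y + (N * s y + N * s y)"
      using wN by (intro add_mono T_bound X_bound mult_right_mono) auto
    finally show ?thesis by simp
  qed
  show ?thesis
  proof (cases "s (D x) = 0")
    case True
    then show ?thesis
      using p.q_nonneg[of x] N_nonneg by (simp add: Re_D)
  next
    case False
    have "(p.s (D x))\<^sup>2 = Re (q (D (D x)) (D x))"
      by (rule p.s_squared)
    also have "\<dots> \<le> s (D (D x)) * s (D x)"
      using cauchy_schwarz[of "D (D x)" "D x"] complex_Re_le_cmod[of "q (D (D x)) (D x)"] by linarith
    also have "\<dots> \<le> 4 * N * (s (D x))\<^sup>2"
      using mult_right_mono[OF sD s_nonneg, of "D x" "D x"] by (simp add: power2_eq_square mult_ac)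
    finally have pD: "(p.s (D x))\<^sup>2 \<le> 4 * N * (s (D x))\<^sup>2" .
    have "(s (D x))\<^sup>2 = cmod (q (D x) (D x))"
      by (simp add: q_self norm_power)
    also have "\<dots> \<le> p.s x * p.s (D x)"
      by (rule p.cauchy_schwarz)
    finally have "((s (D x))\<^sup>2)\<^sup>2 \<le> (p.s x * p.s (D x))\<^sup>2"
      by (rule power_mono) simp
    also have "\<dots> \<le> (p.s x)\<^sup>2 * (4 * N * (s (D x))\<^sup>2)"
      unfolding power_mult_distrib by (intro mult_left_mono pD) simp
    finally have "(s (D x))\<^sup>2 * (s (D x))\<^sup>2 \<le> (4 * N * (p.s x)\<^sup>2) * (s (D x))\<^sup>2"
      by (simp add: power2_eq_square mult_ac)
    moreover have "0 < (s (D x))\<^sup>2"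
      using False by simp
    ultimately have "(s (D x))\<^sup>2 \<le> 4 * N * (p.s x)\<^sup>2"
      by (rule mult_right_le_imp_le)
    then show ?thesis
      by (simp only: p.s_squared Re_D)
  qed
qed

text \<open>One sequence nearly attains both \<open>w\<close> and \<open>N\<close>. The first makes
  the defect \<open>D n (x n)\<close> small, the second makes \<open>X T x - N\<^sup>2 x\<close>
  small; eliminating \<open>X T\<close> leaves a quadratic relation in \<open>X\<close>
  alone.\<close>

lemma approached_of_extremal:
  assumes w: "\<And>x. cmod (q (T x) x) \<le> w * (s x)\<^sup>2" and wN: "w \<le> N" and w0: "0 \<le> w"
    and unit: "\<And>n. s (x n) = 1" and lim: "(\<lambda>n. cmod (q (T (x n)) (x n))) \<longlonglongrightarrow> w"
    and limN: "(\<lambda>n. s (T (x n))) \<longlonglongrightarrow> N"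
  shows "approached (\<lambda>x. cmod (q (T x) x)) N"
proof -
  have "\<exists>c. cmod c = 1 \<and> c * q (T (x n)) (x n) = of_real (cmod (q (T (x n)) (x n)))" for n
    by (rule complex_phase[of "q (T (x n)) (x n)"]) blast
  then obtain c where c: "\<And>n. cmod (c n) = 1"
    and cq: "\<And>n. c n * q (T (x n)) (x n) = of_real (cmod (q (T (x n)) (x n)))"
    by metis
  have cc: "c n * cnj (c n) = 1" for n
    using complex_norm_square[of "c n"] c by simp
  define D where "D n y = of_real (2 * w) *\<^sub>C y - (c n *\<^sub>C T y + cnj (c n) *\<^sub>C X y)" for n y
  have D0: "(\<lambda>n. s (D n (x n))) \<longlonglongrightarrow> 0"
  proof (rule tendsto_zero_if_s_power, rule tendsto_sandwich[of "\<lambda>_. 0"])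
    show "\<forall>\<^sub>F n in sequentially. (s (D n (x n)))\<^sup>2 \<le> 4 * N * (2 * w - 2 * cmod (q (T (x n)) (x n)))"
    proof (intro always_eventually allI)
      show "(s (D n (x n)))\<^sup>2 \<le> 4 * N * (2 * w - 2 * cmod (q (T (x n)) (x n)))" for n
        using defect_bound[OF w wN w0 c D_def, of n "x n"] by (simp only: cq unit) simp
    qed
    have "(\<lambda>n. 4 * N * (2 * w - 2 * cmod (q (T (x n)) (x n)))) \<longlonglongrightarrow> 4 * N * (2 * w - 2 * w)"
      by (intro tendsto_intros lim)
    then show "(\<lambda>n. 4 * N * (2 * w - 2 * cmod (q (T (x n)) (x n)))) \<longlonglongrightarrow> 0"
      by simp
  qed auto
  \<comment> \<open>For a unimodular \<open>c\<close>, \<open>D x \<approx> 0\<close> and \<open>X T x \<approx> N\<^sup>2 x\<close> give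
    \<open>(X\<^sup>2 - 2 w c X + N\<^sup>2 c\<^sup>2) x \<approx> 0\<close>; since \<open>w \<le> N\<close>, both roots have modulus \<open>N\<close>.\<close>
  define r where "r = sqrt (N\<^sup>2 - w\<^sup>2)"
  have r: "r\<^sup>2 = N\<^sup>2 - w\<^sup>2"
    using wN w0 by (simp add: r_def power_mono)
  define k where "k n = c n * Complex w (- r)" for n
  define l where "l n = c n * Complex w r" for n
  have mod: "sqrt (w\<^sup>2 + r\<^sup>2) = N"
    using N_nonneg by (simp add: r)
  have k: "cmod (k n) = N" and l: "cmod (l n) = N" for n
    using mod by (simp_all add: k_def l_def norm_mult c complex_norm)
  have kl_add: "k n + l n = c n * of_real (2 * w)" for n
    by (simp add: k_def l_def complex_eq_iff algebra_simps)
  have "Complex w r * Complex w (- r) = of_real (N\<^sup>2)"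
    using r by (simp add: complex_eq_iff power2_eq_square del: of_real_power)
  then have kl_mult: "l n * k n = c n * c n * of_real (N\<^sup>2)" for n
    by (simp add: k_def l_def mult_ac del: of_real_power)
  let ?e = "\<lambda>n. X (T (x n)) - of_real (N\<^sup>2) *\<^sub>C x n"
  define u where "u n = X (x n) - k n *\<^sub>C x n" for n
  \<comment> \<open>Since \<open>c n\<close> is unimodular, \<open>- c X D\<close> equals
    \<open>X\<^sup>2 - 2 w c X + c\<^sup>2 X T\<close>. Subtracting
    \<open>c\<^sup>2 (X T - N\<^sup>2)\<close> cancels \<open>X T\<close> and leaves
    \<open>(X - l) (X - k)\<close>.\<close>
  have "X (u n) - l n *\<^sub>C u n = (- c n) *\<^sub>C X (D n (x n)) - (c n * c n) *\<^sub>C ?e n" for n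
  proof -
    have "X (u n) - l n *\<^sub>C u n = X (X (x n)) - (k n + l n) *\<^sub>C X (x n) + (l n * k n) *\<^sub>C x n"
      by (simp add: u_def X_diff X_scaleC scaleC_expand)
    moreover have "(- c n) *\<^sub>C X (D n (x n)) - (c n * c n) *\<^sub>C ?e n
      = (c n * cnj (c n)) *\<^sub>C X (X (x n)) - (c n * of_real (2 * w)) *\<^sub>C X (x n)
        + (c n * c n * of_real (N\<^sup>2)) *\<^sub>C x n"
      unfolding D_def
      by (simp add: X_diff X_add X_scaleC scaleC_expand del: of_real_power of_real_mult)
    ultimately show ?thesis
      by (simp only: kl_add kl_mult cc scaleC_one)
  qed
  moreover have "(\<lambda>n. s ((- c n) *\<^sub>C X (D n (x n)) - (c n * c n) *\<^sub>C ?e n)) \<longlonglongrightarrow> 0"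
  proof (rule tendsto_sandwich[of "\<lambda>_. 0"])
    have "s ((- c n) *\<^sub>C X (D n (x n)) - (c n * c n) *\<^sub>C ?e n) \<le> N * s (D n (x n)) + s (?e n)" for n
      using s_triangle_diff[of "(- c n) *\<^sub>C X (D n (x n))" "(c n * c n) *\<^sub>C ?e n"]
        X_bound[of "D n (x n)"] by (simp add: s_scaleC norm_mult c del: complex_vector.scale_minus_left)
    then show "\<forall>\<^sub>F n in sequentially. s ((- c n) *\<^sub>C X (D n (x n)) - (c n * c n) *\<^sub>C ?e n)
        \<le> N * s (D n (x n)) + s (?e n)"
      by (intro always_eventually allI)
    have "(\<lambda>n. N * s (D n (x n)) + s (?e n)) \<longlonglongrightarrow> N * 0 + 0"
      by (intro tendsto_intros D0 XT_aligned[OF unit limN])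
    then show "(\<lambda>n. N * s (D n (x n)) + s (?e n)) \<longlonglongrightarrow> 0"
      by simp
  qed auto
  ultimately have quad: "(\<lambda>n. s (X (u n) - l n *\<^sub>C u n)) \<longlonglongrightarrow> 0"
    by simp
  \<comment> \<open>The eigenvectors belong to \<open>X\<close>, but by \<open>numerical_X\<close>
    its numerical values have the same moduli as those of \<open>T\<close>.\<close>
  have "approached (\<lambda>x. cmod (q (X x) x)) N"
  proof (rule approached_of_quadratic_factor[OF unit _ X_scaleC k l u_def quad])
    show "cmod (q (X x) x) \<le> N" if "s x = 1" for x
      using numerical_le[of x] that by (simp add: numerical_X)
  qed
  then show ?thesis
    by (simp add: numerical_X)
qed

lemma approached_davis_wielandt_iff:
  assumes w: "\<And>x. cmod (q (T x) x) \<le> w * (s x)\<^sup>2" and wN: "w \<le> N" and w0: "0 \<le> w"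
  shows "approached (\<lambda>x. sqrt ((cmod (q (T x) x))\<^sup>2 + s (T x) ^ 4)) (sqrt (w\<^sup>2 + N ^ 4))
    \<longleftrightarrow> approached (\<lambda>x. cmod (q (T x) x)) N"
proof
  assume "approached (\<lambda>x. sqrt ((cmod (q (T x) x))\<^sup>2 + s (T x) ^ 4)) (sqrt (w\<^sup>2 + N ^ 4))"
  then obtain x :: "nat \<Rightarrow> 'a" where unit: "\<And>n. s (x n) = 1"
    and lim: "(\<lambda>n. sqrt ((cmod (q (T (x n)) (x n)))\<^sup>2 + s (T (x n)) ^ 4)) \<longlonglongrightarrow> sqrt (w\<^sup>2 + N ^ 4)"
    by (auto simp: approached_def)
  define a b where "a n = (cmod (q (T (x n)) (x n)))\<^sup>2" and "b n = s (T (x n)) ^ 4" for n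
  have a: "0 \<le> a n" "a n \<le> w\<^sup>2" for n
    using w[of "x n"] unit[of n] by (auto simp: a_def power_mono)
  have b: "0 \<le> b n" "b n \<le> N ^ 4" for n
    using T_bound[of "x n"] unit[of n] by (auto simp: b_def power_mono)
  have "(\<lambda>n. (sqrt (a n + b n))\<^sup>2) \<longlonglongrightarrow> (sqrt (w\<^sup>2 + N ^ 4))\<^sup>2"
    unfolding a_def b_def by (intro tendsto_intros lim)
  then have ab: "(\<lambda>n. a n + b n) \<longlonglongrightarrow> w\<^sup>2 + N ^ 4"
    using a(1) b(1) N_nonneg by simp
  \<comment> \<open>Each summand is bounded by its own maximum, so a sum tending to the total of the
    maxima forces each summand to its maximum.\<close>
  have alim: "a \<longlonglongrightarrow> w\<^sup>2"
  proof (rule tendsto_sandwich[of "\<lambda>n. a n + b n - N ^ 4" _ _ "\<lambda>_. w\<^sup>2"])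
    show "(\<lambda>n. a n + b n - N ^ 4) \<longlonglongrightarrow> w\<^sup>2"
      using tendsto_diff[OF ab tendsto_const[of "N ^ 4"]] by simp
  qed (use a b in auto)
  have blim: "b \<longlonglongrightarrow> N ^ 4"
    using tendsto_diff[OF ab alim] by simp
  have "(\<lambda>n. cmod (q (T (x n)) (x n))) \<longlonglongrightarrow> w"
    using tendsto_real_sqrt[OF alim] w0 by (simp add: a_def)
  moreover have "(\<lambda>n. s (T (x n))) \<longlonglongrightarrow> N"
    using tendsto_real_root[OF blim, of 4] N_nonneg by (simp add: b_def real_root_power_cancel)
  ultimately show "approached (\<lambda>x. cmod (q (T x) x)) N"
    by (rule approached_of_extremal[OF w wN w0 unit])
next
  assume "approached (\<lambda>x. cmod (q (T x) x)) N"
  then obtain x :: "nat \<Rightarrow> 'a" where unit: "\<And>n. s (x n) = 1"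
    and lim: "(\<lambda>n. cmod (q (T (x n)) (x n))) \<longlonglongrightarrow> N"
    by (auto simp: approached_def)
  \<comment> \<open>Values bounded by \<open>w\<close> tend to \<open>N\<close>, which leaves only
    \<open>w = N\<close>.\<close>
  have "cmod (q (T (x n)) (x n)) \<le> w" for n
    using w[of "x n"] unit by simp
  then have "N \<le> w"
    by (intro LIMSEQ_le_const2[OF lim]) auto
  then have wN': "w = N"
    using wN by simp
  have "(\<lambda>n. sqrt ((cmod (q (T (x n)) (x n)))\<^sup>2 + s (T (x n)) ^ 4)) \<longlonglongrightarrow> sqrt (w\<^sup>2 + N ^ 4)"
    unfolding wN' by (intro tendsto_intros lim norm_tendsto_of_numerical[OF unit lim])
  with unit show "approached (\<lambda>x. sqrt ((cmod (q (T x) x))\<^sup>2 + s (T x) ^ 4)) (sqrt (w\<^sup>2 + N ^ 4))"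
    unfolding approached_def by blast
qed

end

subsection \<open>Riesz representation and adjoints\<close>

text \<open>The vector \<open>y\<close> minimises \<open>\<phi>\<close> over \<open>M\<close>. With
  \<open>M\<close> the whole space this is the Riesz theorem, used for adjoints; with
  \<open>f\<close> the inner product with a fixed vector it is orthogonal projection onto
  \<open>M\<close>.\<close>

lemma riesz_closed_subspace:
  fixes f :: "'a::{real_inner, complete_space} \<Rightarrow> real"
  assumes f: "bounded_linear f" and M: "subspace M" "closed M"
  obtains y where "y \<in> M" "\<And>h. h \<in> M \<Longrightarrow> f h = inner y h"
proof -
  interpret f: bounded_linear f by (rule f)
  define \<phi> where "\<phi> y = (norm y)\<^sup>2 - 2 * f y" for y
  define m where "m = (INF y\<in>M. \<phi> y)"
  obtain K where K: "\<And>x. \<bar>f x\<bar> \<le> norm x * K"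
    using f.bounded by auto
  have lower: "- (K\<^sup>2) \<le> \<phi> y" for y
  proof -
    have "0 \<le> (norm y - K)\<^sup>2"
      by simp
    then show ?thesis
      using K[of y] by (simp add: \<phi>_def power2_diff)
  qed
  have bdd: "bdd_below (\<phi> ` M)"
    using lower by (intro bdd_belowI2[of _ "- (K\<^sup>2)"])
  have m_le: "m \<le> \<phi> y" if "y \<in> M" for y
    unfolding m_def using bdd that by (rule cINF_lower)
  have ne: "M \<noteq> {}"
    using subspace_0[OF M(1)] by blast
  have "\<exists>y\<in>M. \<phi> y < m + inverse (real (Suc n))" for n
  proof -
    have "(INF y\<in>M. \<phi> y) < m + inverse (real (Suc n))"
      by (simp add: m_def)
    then show ?thesis
      using cINF_less_iff[OF ne bdd] by blast
  qed
  then obtain y where yM: "\<And>n. y n \<in> M" and y: "\<And>n. \<phi> (y n) < m + inverse (real (Suc n))"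
    by metis
  \<comment> \<open>The parallelogram identity, with \<open>m\<close> as lower bound at the
    midpoint, bounds the distance between near-minimisers; this makes \<open>y\<close> a Cauchy
    sequence.\<close>
  have para: "(norm (a - b))\<^sup>2 \<le> 2 * (\<phi> a - m) + 2 * (\<phi> b - m)" if "a \<in> M" "b \<in> M" for a b
  proof -
    have "(1 / 2) *\<^sub>R (a + b) \<in> M"
      using that M(1) by (simp add: subspace_add subspace_scale)
    then have "m \<le> \<phi> ((1 / 2) *\<^sub>R (a + b))"
      by (rule m_le)
    also have "\<phi> ((1 / 2) *\<^sub>R (a + b)) = (norm (a + b))\<^sup>2 / 4 - (f a + f b)"
      unfolding \<phi>_def norm_scaleR f.scaleR f.add by (simp add: power_divide add_divide_distrib)
    finally have "4 * m \<le> (norm (a + b))\<^sup>2 - 4 * (f a + f b)"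
      by simp
    moreover have "(norm (a + b))\<^sup>2 + (norm (a - b))\<^sup>2 = 2 * (norm a)\<^sup>2 + 2 * (norm b)\<^sup>2"
      by (simp add: power2_norm_eq_inner inner_simps inner_commute)
    ultimately show ?thesis
      by (simp add: \<phi>_def)
  qed
  have "Cauchy y"
  proof (rule metric_CauchyI)
    fix e :: real assume e: "e > 0"
    obtain N where N: "inverse (real (Suc N)) < e\<^sup>2 / 4"
      using reals_Archimedean[of "e\<^sup>2 / 4"] e by auto
    have small: "\<phi> (y n) - m < e\<^sup>2 / 4" if "n \<ge> N" for n
    proof -
      have "inverse (real (Suc n)) \<le> inverse (real (Suc N))"
        using that by (intro le_imp_inverse_le) auto
      then show ?thesis
        using y[of n] N by linarith
    qed
    have "dist (y i) (y j) < e" if "i \<ge> N" "j \<ge> N" for i j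
    proof -
      have "2 * (\<phi> (y i) - m) + 2 * (\<phi> (y j) - m) < e\<^sup>2"
        using small[OF that(1)] small[OF that(2)] by argo
      with para[OF yM yM] have "(norm (y i - y j))\<^sup>2 < e\<^sup>2"
        by (rule le_less_trans)
      then show ?thesis
        using e by (simp add: dist_norm power2_less_imp_less)
    qed
    then show "\<exists>N. \<forall>i\<ge>N. \<forall>j\<ge>N. dist (y i) (y j) < e"
      by blast
  qed
  then obtain z where z: "y \<longlonglongrightarrow> z"
    using Cauchy_convergent convergent_def by blast
  have zM: "z \<in> M"
    by (rule closed_sequentially[OF M(2) yM z])
  have "(\<lambda>n. \<phi> (y n)) \<longlonglongrightarrow> \<phi> z"
    unfolding \<phi>_def by (intro tendsto_intros z f.tendsto)
  moreover have "(\<lambda>n. m + inverse (real (Suc n))) \<longlonglongrightarrow> m + 0"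
    by (intro tendsto_intros LIMSEQ_inverse_real_of_nat)
  ultimately have z_min: "\<phi> z \<le> m"
    using y by (intro LIMSEQ_le[of "\<lambda>n. \<phi> (y n)" _ "\<lambda>n. m + inverse (real (Suc n))"])
      (auto intro: less_imp_le)
  have "f h = inner z h" if h: "h \<in> M" for h
  proof (rule ccontr)
    define d H where "d = inner z h - f h" and "H = (norm h)\<^sup>2"
    assume "f h \<noteq> inner z h"
    then have d: "d \<noteq> 0"
      by (simp add: d_def)
    \<comment> \<open>Close to the minimiser \<open>- d / H\<close> of \<open>\<phi>\<close> along
      the line through \<open>z\<close> in direction \<open>h\<close>. The added 1 keeps the
      denominator positive, and the change \<open>- (t\<^sup>2 * (H + 2))\<close> is still
      negative.\<close>
    define t where "t = - d / (H + 1)"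
    have H: "0 \<le> H"
      by (simp add: H_def)
    have "z + t *\<^sub>R h \<in> M"
      using zM h M(1) by (simp add: subspace_add subspace_scale)
    then have "\<phi> z \<le> \<phi> (z + t *\<^sub>R h)"
      using z_min m_le by force
    also have "\<dots> = \<phi> z + 2 * t * d + t\<^sup>2 * H"
    proof -
      have "(norm (z + t *\<^sub>R h))\<^sup>2 = (norm z)\<^sup>2 + 2 * t * inner z h + t\<^sup>2 * (norm h)\<^sup>2"
        unfolding power2_norm_eq_inner
        by (simp add: inner_simps inner_commute power2_eq_square algebra_simps)
      then show ?thesis
        by (simp add: \<phi>_def d_def H_def f.add f.scaleR algebra_simps)
    qed
    finally have "0 \<le> 2 * t * d + t\<^sup>2 * H"
      by simp
    moreover have "d = - t * (H + 1)"
      using H by (simp add: t_def)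
    ultimately have "0 \<le> - (t\<^sup>2 * (H + 2))"
      by (simp add: power2_eq_square algebra_simps)
    moreover have "0 < t\<^sup>2 * (H + 2)"
      using d H by (simp add: t_def)
    ultimately show False
      by simp
  qed
  with zM that show thesis
    by blast
qed

lemma subspace_closure:
  fixes S :: "'a::real_normed_vector set"
  assumes S: "subspace S"
  shows "subspace (closure S)"
proof (rule subspaceI)
  show "0 \<in> closure S"
    using closure_subset subspace_0[OF S] by blast
  fix x y c assume "x \<in> closure S"
  then obtain f where f: "\<And>n. f n \<in> S" "f \<longlonglongrightarrow> x"
    by (auto simp: closure_sequential)
  have "(\<lambda>n. c *\<^sub>R f n) \<longlonglongrightarrow> c *\<^sub>R x" "\<forall>n. c *\<^sub>R f n \<in> S"
    using f S by (auto intro: tendsto_intros subspace_scale)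
  then show "c *\<^sub>R x \<in> closure S"
    unfolding closure_sequential by (intro exI conjI)
  assume "y \<in> closure S"
  then obtain g where g: "\<And>n. g n \<in> S" "g \<longlonglongrightarrow> y"
    by (auto simp: closure_sequential)
  have "(\<lambda>n. f n + g n) \<longlonglongrightarrow> x + y" "\<forall>n. f n + g n \<in> S"
    using f g S by (auto intro: tendsto_intros subspace_add)
  then show "x + y \<in> closure S"
    unfolding closure_sequential by (intro exI conjI)
qed

section \<open>Complex adjoints from the real representation theorem\<close>

interpretation cinner: semi_inner_form "cinner :: 'a::complex_inner \<Rightarrow> 'a \<Rightarrow> complex"
  by unfold_locales
    (simp_all add: cinner_add_left cinner_scaleC_left cinner_self flip: cinner_commute)

lemma norm_scaleC: "norm (c *\<^sub>C x) = cmod c * norm (x :: 'a::complex_inner)"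
proof -
  have "norm y = cinner.s y" for y :: 'a
    by (simp add: cinner.s_def cinner_self)
  then show ?thesis
    by (simp add: cinner.s_scaleC)
qed

lemma bounded_linear_scaleC: "bounded_linear (\<lambda>x :: 'a::complex_inner. c *\<^sub>C x)"
  by (rule bounded_linear_intro[of _ "cmod c"])
    (simp_all add: scaleC_add_right scaleR_scaleC norm_scaleC scaleC_scaleC mult.commute)

lemma cinner_eqI:
  fixes u v :: "'a::complex_inner"
  assumes "\<And>x. cinner x u = cinner x v"
  shows "u = v"
proof -
  have "cinner (u - v) (u - v) = 0"
    using assms[of "u - v"] by (simp add: cinner.q_diff_right)
  then show ?thesis
    by (simp add: cinner_self)
qed

text \<open>The representation theorem gives only real identities. Using one at
  \<open>\<i> *\<^sub>C x\<close> as well recovers the imaginary part.\<close>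

lemma cinner_eq_of_inner_eq:
  fixes y z :: "'a::complex_inner"
  assumes F: "\<And>c x. F (c *\<^sub>C x) = c *\<^sub>C F x" and eq: "\<And>x. inner (F x) y = inner x z"
  shows "cinner (F x) y = cinner x z"
proof (rule complex_eqI)
  show "Re (cinner (F x) y) = Re (cinner x z)"
    using eq[of x] by (simp add: inner_eq_Re_cinner)
  show "Im (cinner (F x) y) = Im (cinner x z)"
    using eq[of "\<i> *\<^sub>C x"] by (simp add: F inner_eq_Re_cinner cinner_scaleC_left)
qed

text \<open>Justifies the definite description in \<open>cadjoint\<close>: representation on the
  whole space gives existence, \<open>cinner_eqI\<close> gives uniqueness.\<close>

lemma cinner_cadjoint:
  fixes T :: "'a::chilbert_space \<Rightarrow> 'a"
  assumes "bounded_clinear T"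
  shows "bounded_clinear (cadjoint T)" "cinner (T x) y = cinner x (cadjoint T y)"
proof -
  have T: "bounded_linear T" and T_scaleC: "\<And>c x. T (c *\<^sub>C x) = c *\<^sub>C T x"
    using assms by (auto simp: bounded_clinear_def)
  have "\<exists>z. \<forall>x. cinner (T x) y = cinner x z" for y
  proof -
    have "bounded_linear (\<lambda>x. inner (T x) y)"
      by (rule bounded_linear_compose[OF bounded_linear_inner_left T])
    then obtain z where "\<And>x. inner (T x) y = inner z x"
      by (rule riesz_closed_subspace[of _ UNIV]) auto
    then show ?thesis
      using cinner_eq_of_inner_eq[OF T_scaleC] by (metis inner_commute)
  qed
  then obtain S where S: "\<And>x y. cinner (T x) y = cinner x (S y)"
    by metis
  obtain K where K: "\<And>x. norm (T x) \<le> norm x * K"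
    using bounded_linear.bounded[OF T] by auto
  have S_add: "S (x + y) = S x + S y" and S_scaleC: "S (c *\<^sub>C x) = c *\<^sub>C S x" for c x y
    by (rule cinner_eqI, simp add: cinner.q_simps flip: S)+
  have S_norm: "norm (S y) \<le> norm y * K" for y
  proof (cases "S y = 0")
    case True
    then show ?thesis
      using order_trans[OF norm_ge_zero K[of y]] by simp
  next
    case False
    have "(norm (S y))\<^sup>2 = inner (T (S y)) y"
      by (simp add: power2_norm_eq_inner inner_eq_Re_cinner S)
    also have "\<dots> \<le> norm (T (S y)) * norm y"
      by (rule norm_cauchy_schwarz)
    also have "\<dots> \<le> (norm (S y) * K) * norm y"
      by (intro mult_right_mono K) simp
    finally have "norm (S y) * norm (S y) \<le> (norm y * K) * norm (S y)"
      by (simp add: power2_eq_square mult_ac)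
    then show ?thesis
      using False by (simp add: mult_le_cancel_right)
  qed
  have S_bounded: "bounded_clinear S"
    unfolding bounded_clinear_def
    by (intro conjI allI S_scaleC bounded_linear_intro[of _ K])
      (simp_all add: S_add S_scaleC scaleR_scaleC S_norm)
  have "\<exists>!S. bounded_clinear S \<and> (\<forall>x y. cinner (T x) y = cinner x (S y))"
  proof (rule ex1I[of _ S], intro conjI allI S S_bounded)
    fix R assume "bounded_clinear R \<and> (\<forall>x y. cinner (T x) y = cinner x (R y))"
    then show "R = S"
      by - (rule ext, rule cinner_eqI, simp flip: S)
  qed
  from theI'[OF this] show "bounded_clinear (cadjoint T)" "cinner (T x) y = cinner x (cadjoint T y)"
    unfolding cadjoint_def by blast+
qed

text \<open>Polarisation: reality of the quadratic form at \<open>x + y\<close> settles the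
  imaginary part of the conjugate symmetry, and at \<open>x + \<i> *\<^sub>C y\<close> the real
  part.\<close>

lemma positive_op_symmetric:
  fixes A :: "'a::complex_inner \<Rightarrow> 'a"
  assumes "bounded_clinear A" "positive_op A"
  shows "cinner (A x) y = cinner x (A y)"
proof -
  have A_add: "A (u + v) = A u + A v" and A_scaleC: "A (c *\<^sub>C u) = c *\<^sub>C A u" for u v c
    using assms(1) by (auto simp: bounded_clinear_def linear_add bounded_linear.linear)
  have "Im (cinner (A u) u) = 0" for u
    using assms(2) by (auto simp: positive_op_def complex_nonneg_Reals_iff)
  from this[of x] this[of y] this[of "x + y"] this[of "x + \<i> *\<^sub>C y"]
  have "cinner (A x) y = cnj (cinner (A y) x)"
    by (simp add: A_add A_scaleC cinner.q_simps complex_eq_iff)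
  then show ?thesis
    using cinner_commute[of x "A y"] by simp
qed

subsection \<open>The adjoint with respect to a positive operator\<close>

context semi_inner_form
begin

text \<open>
  The numbers \<open>s (S\<^sup>k x)\<close> form a log-convex sequence, so their growth rate bounds the first ratio.
\<close>

lemma symmetric_bound_of_power_growth:
  assumes sym: "\<And>x y. q (S x) y = q x (S y)" and K: "0 < K"
    and growth: "\<And>k. s ((S ^^ k) x) \<le> C * K ^ k"
  shows "s (S x) \<le> K * s x"
proof (cases "s x = 0")
  case True
  have "(s (S x))\<^sup>2 \<le> s (S (S x)) * s x"
    using cauchy_schwarz[of "S (S x)" x] complex_Re_le_cmod[of "q (S (S x)) x"]
    by (simp add: s_squared sym)
  then show ?thesis
    using True by simp
next
  case False
  define a where "a k = s ((S ^^ k) x)" for k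
  have a_nonneg: "0 \<le> a k" for k
    by (simp add: a_def)
  have a0: "0 < a 0"
    using False s_nonneg[of x] by (auto simp: a_def order_less_le)
  have convex: "(a (Suc k))\<^sup>2 \<le> a (Suc (Suc k)) * a k" for k
    using cauchy_schwarz[of "S (S ((S ^^ k) x))" "(S ^^ k) x"]
      complex_Re_le_cmod[of "q (S (S ((S ^^ k) x))) ((S ^^ k) x)"]
    by (simp add: a_def s_squared sym)
  define r where "r = a 1 / a 0"
  have r: "0 \<le> r"
    using a_nonneg[of 1] a_nonneg[of 0] by (simp add: r_def)
  \<comment> \<open>By log-convexity the ratio of consecutive terms never drops below the first one.
    A zero term makes the next term zero as well, so that case needs no division.\<close>
  have ratio: "r * a k \<le> a (Suc k)" for k
  proof (induction k)
    case 0
    then show ?case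
      using a0 by (simp add: r_def)
  next
    case (Suc k)
    show ?case
    proof (cases "a k = 0")
      case True
      then have "a (Suc k) = 0"
        using convex[of k] by simp
      then show ?thesis
        using a_nonneg by simp
    next
      case False
      have "(r * a (Suc k)) * a k \<le> a (Suc k) * a (Suc k)"
        using mult_left_mono[OF Suc a_nonneg[of "Suc k"]] by (simp add: mult_ac)
      also have "\<dots> \<le> a (Suc (Suc k)) * a k"
        using convex[of k] by (simp add: power2_eq_square)
      finally show ?thesis
        using False a_nonneg[of k] by (simp add: mult_le_cancel_right)
    qed
  qed
  have geometric: "r ^ k * a 0 \<le> a k" for k
  proof (induction k)
    case (Suc k)
    then have "r * (r ^ k * a 0) \<le> r * a k"
      using r by (rule mult_left_mono)
    with ratio[of k] show ?case
      by (simp add: mult_ac)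
  qed simp
  have "r \<le> K"
  proof (rule ccontr)
    assume "\<not> r \<le> K"
    then have "1 < r / K"
      using K by simp
    then obtain k where "C / a 0 < (r / K) ^ k"
      using real_arch_pow by blast
    then have "C * K ^ k < r ^ k * a 0"
      using K a0 by (simp add: power_divide field_simps)
    then show False
      using geometric[of k] growth[of k] by (simp add: a_def)
  qed
  then show ?thesis
    using a0 by (simp add: r_def a_def pos_divide_le_eq)
qed

end

text \<open>Justifies the definite description in \<open>semi_adjoint\<close>. The range condition
  in \<open>semi_ops A\<close> yields preimages under \<open>A\<close>; projecting them onto the
  closure of the range makes the choice unique and therefore linear, and the Baire theorem yields
  boundedness.\<close>

lemma
  fixes A T :: "'a::chilbert_space \<Rightarrow> 'a"
  assumes A: "bounded_clinear A" "positive_op A" and T: "T \<in> semi_ops A"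
  shows bounded_clinear_semi_adjoint: "bounded_clinear (semi_adjoint A T)"
    and semi_inner_semi_adjoint: "semi_inner A (T x) y = semi_inner A x (semi_adjoint A T y)"
proof -
  have T_lin: "bounded_clinear T" and T_range: "\<And>x. cadjoint T (A x) \<in> range A"
    using T by (auto simp: semi_ops_def)
  have bA: "bounded_linear A" and A_scaleC: "\<And>c x. A (c *\<^sub>C x) = c *\<^sub>C A x"
    using A(1) by (auto simp: bounded_clinear_def)
  interpret A: bounded_linear A by (rule bA)
  interpret T: bounded_linear T using T_lin by (simp add: bounded_clinear_def)
  interpret R: bounded_linear "cadjoint T"
    using cinner_cadjoint(1)[OF T_lin] by (simp add: bounded_clinear_def)
  have R_scaleC: "cadjoint T (c *\<^sub>C x) = c *\<^sub>C cadjoint T x" for c x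
    using cinner_cadjoint(1)[OF T_lin] by (simp add: bounded_clinear_def)
  have A_sym: "cinner (A x) y = cinner x (A y)" for x y
    by (rule positive_op_symmetric[OF A])
  have A_sym': "inner (A x) y = inner x (A y)" for x y
    by (simp add: inner_eq_Re_cinner A_sym)
  define M where "M = closure (range A)"
  have subspace_range: "subspace (range A)"
    by (rule linear_subspace_image[OF A.linear subspace_UNIV])
  have M: "subspace M" "closed M" "range A \<subseteq> M"
    unfolding M_def using subspace_closure[OF subspace_range] by (auto intro: closure_subset[THEN subsetD])
  have M_scaleC: "c *\<^sub>C u \<in> M" if "u \<in> M" for c u
  proof -
    have "(*\<^sub>C) c ` M \<subseteq> closure ((*\<^sub>C) c ` range A)"
      unfolding M_def by (rule closure_bounded_linear_image_subset[OF bounded_linear_scaleC])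
    also have "\<dots> \<subseteq> M"
      unfolding M_def by (rule closure_mono) (auto simp flip: A_scaleC)
    finally show ?thesis
      using that by blast
  qed
  \<comment> \<open>Vectors of \<open>M\<close> are limits of vectors \<open>A w\<close>, so inner
    products with the range of \<open>A\<close> already control their norm.\<close>
  have norm_le: "norm u \<le> K" if u: "u \<in> M" and K: "0 \<le> K"
    and le: "\<And>w. \<bar>inner u (A w)\<bar> \<le> K * norm (A w)" for u K
  proof (cases "u = 0")
    case False
    have "closed {v. \<bar>inner u v\<bar> \<le> K * norm v}"
      by (intro closed_Collect_le continuous_intros)
    moreover have "range A \<subseteq> {v. \<bar>inner u v\<bar> \<le> K * norm v}"
      using le by auto
    ultimately have "M \<subseteq> {v. \<bar>inner u v\<bar> \<le> K * norm v}"
      unfolding M_def by (rule closure_minimal[rotated])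
    then have "\<bar>inner u u\<bar> \<le> K * norm u"
      using u by blast
    then have "norm u * norm u \<le> K * norm u"
      by (simp add: power2_norm_eq_inner[symmetric] power2_eq_square)
    then show ?thesis
      using False by (simp add: mult_le_cancel_right)
  qed (use K in simp)
  have kernel: "u = 0" if "u \<in> M" "A u = 0" for u
  proof -
    have "inner u (A w) = 0" for w
      using A_sym'[of u w] that(2) by simp
    then have "norm u \<le> 0"
      by (intro norm_le that(1)) auto
    then show ?thesis by simp
  qed
  have unique: "u = v" if "u \<in> M" "v \<in> M" "A u = A v" for u v
    using kernel[of "u - v"] that M(1) by (simp add: A.diff subspace_diff)
  have "\<exists>u\<in>M. A u = cadjoint T (A x)" for x
  proof -
    obtain w where w: "A w = cadjoint T (A x)"
      using T_range[of x] by (metis imageE)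
    \<comment> \<open>Here \<open>u\<close> is the orthogonal projection of \<open>w\<close> onto
      \<open>M\<close>. The difference \<open>w - u\<close> is orthogonal to the range of the
      symmetric \<open>A\<close>, hence lies in its kernel.\<close>
    from riesz_closed_subspace[OF bounded_linear_inner_right[of w] M(1,2)]
    obtain u where u: "u \<in> M" "\<And>h. h \<in> M \<Longrightarrow> inner w h = inner u h"
      by blast
    have "inner (A (w - u)) z = 0" for z
    proof -
      have "inner (w - u) (A z) = 0"
        using u(2)[of "A z"] M(3) by (auto simp: inner_diff_left)
      then show ?thesis
        by (simp add: A_sym')
    qed
    then have "A (w - u) = 0"
      by (metis inner_eq_zero_iff)
    then show ?thesis
      using u(1) w by (auto simp: A.diff)
  qed
  then obtain X where XM: "\<And>x. X x \<in> M" and AX: "\<And>x. A (X x) = cadjoint T (A x)"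
    by metis
  have X_add: "X (x + y) = X x + X y" and X_scaleC: "X (c *\<^sub>C x) = c *\<^sub>C X x" for x y c
    by (rule unique; simp add: XM AX M_scaleC subspace_add[OF M(1)] A.add R.add A_scaleC R_scaleC)+
  have X_inner: "inner (X x) (A w) = inner x (A (T w))" for x w
  proof -
    have "cinner (X x) (A w) = cinner x (A (T w))"
      using arg_cong[OF cinner_cadjoint(2)[OF T_lin, of w "A x"], of cnj]
      by (simp add: A_sym AX flip: cinner_commute) (simp add: A_sym AX flip: A_sym[of "X x"])
    then show ?thesis
      by (simp add: inner_eq_Re_cinner)
  qed
  define E where "E n = {x. norm (X x) \<le> real n}" for n :: nat
  \<comment> \<open>Continuity of \<open>X\<close> is still open, so closedness of
    \<open>E n\<close> is drawn from this description by conditions that are continuous in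
    \<open>x\<close>.\<close>
  have E_eq: "E n = (\<Inter>w. {x. \<bar>inner x (A (T w))\<bar> \<le> real n * norm (A w)})" for n
  proof (intro equalityI subsetI)
    fix x assume x: "x \<in> E n"
    have "\<bar>inner (X x) (A w)\<bar> \<le> real n * norm (A w)" for w
      using order_trans[OF Cauchy_Schwarz_ineq2[of "X x" "A w"] mult_right_mono[of "norm (X x)" "real n"]] x
      by (simp add: E_def)
    then show "x \<in> (\<Inter>w. {x. \<bar>inner x (A (T w))\<bar> \<le> real n * norm (A w)})"
      by (simp add: X_inner)
  next
    fix x assume "x \<in> (\<Inter>w. {x. \<bar>inner x (A (T w))\<bar> \<le> real n * norm (A w)})"
    then have "norm (X x) \<le> real n"
      by (intro norm_le XM) (auto simp: X_inner)
    then show "x \<in> E n"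
      by (simp add: E_def)
  qed
  have E_closed: "closed (E n)" for n
    unfolding E_eq by (intro closed_INT ballI closed_Collect_le continuous_intros)
  have "\<exists>n. interior (E n) \<noteq> {}"
  proof (rule ccontr)
    assume "\<nexists>n. interior (E n) \<noteq> {}"
    then have "Met_TC.mtopology interior_of (\<Union>(range E)) = {}"
      by (intro Met_TC.metric_Baire_category_alt)
        (auto simp: E_closed Met_TC.mcomplete_def complete_UNIV)
    moreover have "\<Union>(range E) = UNIV"
      using real_arch_simple by (auto simp: E_def)
    ultimately show False
      by simp
  qed
  then obtain n x0 where "x0 \<in> interior (E n)"
    by blast
  then obtain e where e: "e > 0" "cball x0 e \<subseteq> E n"
    by (auto simp: mem_interior_cball)
  \<comment> \<open>\<open>X h\<close> is the difference of the values of \<open>X\<close> at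
    \<open>x0 + h\<close> and \<open>x0\<close>, two points of the ball inside
    \<open>E n\<close>.\<close>
  have X_small: "norm (X h) \<le> 2 * real n" if "norm h \<le> e" for h
  proof -
    have "x0 + h \<in> E n" "x0 \<in> E n"
      using e that by (auto simp: subset_eq dist_norm)
    moreover have "norm (X h) \<le> norm (X (x0 + h)) + norm (X x0)"
      using norm_triangle_ineq4[of "X (x0 + h)" "X x0"] by (simp add: X_add)
    ultimately show ?thesis
      by (simp add: E_def)
  qed
  have X_norm: "norm (X h) \<le> norm h * (2 * real n / e)" for h
  proof (cases "h = 0")
    case True
    then show ?thesis
      using X_add[of 0 0] by simp
  next
    case False
    have "norm (X (complex_of_real (e / norm h) *\<^sub>C h)) \<le> 2 * real n"
      using False e(1) by (intro X_small) (simp add: norm_scaleC norm_divide)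
    then show ?thesis
      using False e(1) by (simp add: X_scaleC norm_scaleC norm_divide field_simps)
  qed
  have X: "bounded_clinear X"
    unfolding bounded_clinear_def
    by (intro conjI allI X_scaleC bounded_linear_intro[of _ "2 * real n / e"] X_norm)
      (simp_all add: X_add X_scaleC scaleR_scaleC)
  have "\<exists>!X. bounded_clinear X \<and> A \<circ> X = cadjoint T \<circ> A \<and> range X \<subseteq> closure (range A)"
  proof (rule ex1I[of _ X])
    show "bounded_clinear X \<and> A \<circ> X = cadjoint T \<circ> A \<and> range X \<subseteq> closure (range A)"
      using X XM AX by (auto simp: M_def)
    fix Y assume Y: "bounded_clinear Y \<and> A \<circ> Y = cadjoint T \<circ> A \<and> range Y \<subseteq> closure (range A)"
    show "Y = X"
    proof
      fix x
      have "Y x \<in> M" "A (Y x) = cadjoint T (A x)"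
        using Y by (auto simp: M_def fun_eq_iff)
      then show "Y x = X x"
        using unique[of "Y x" "X x"] XM AX by simp
    qed
  qed
  from theI'[OF this] have sharp: "bounded_clinear (semi_adjoint A T)"
    "A \<circ> semi_adjoint A T = cadjoint T \<circ> A"
    unfolding semi_adjoint_def by blast+
  show "bounded_clinear (semi_adjoint A T)"
    by (rule sharp)
  have "A (semi_adjoint A T y) = cadjoint T (A y)"
    using sharp(2) by (simp add: fun_eq_iff)
  then show "semi_inner A (T x) y = semi_inner A x (semi_adjoint A T y)"
    by (simp add: semi_inner_def A_sym cinner_cadjoint(2)[OF T_lin])
qed

section \<open>From the abstract form to the form given by a positive operator\<close>

lemma semi_inner_form_semi_inner:
  fixes A :: "'a::complex_inner \<Rightarrow> 'a"
  assumes A: "bounded_clinear A" "positive_op A"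
  shows "semi_inner_form (semi_inner A)"
proof
  fix x y z :: 'a and c :: complex
  show "semi_inner A x y = cnj (semi_inner A y x)"
    unfolding semi_inner_def positive_op_symmetric[OF A, of x] by (rule cinner_commute)
  show "semi_inner A (x + y) z = semi_inner A x z + semi_inner A y z"
    "semi_inner A (c *\<^sub>C x) y = c * semi_inner A x y"
    using A(1) by (simp_all add: bounded_clinear_def semi_inner_def cinner_add_left
        cinner_scaleC_left linear_add bounded_linear.linear)
  show "0 \<le> Re (semi_inner A x x)"
    using A(2) by (simp add: positive_op_def semi_inner_def complex_nonneg_Reals_iff)
qed

text \<open>The product \<open>X T\<close> is symmetric for the form and bounded in norm. As the
  norm dominates the seminorm, its powers grow at most geometrically, so
  \<open>symmetric_bound_of_power_growth\<close> bounds it in the seminorm;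
  \<open>(s (T x))\<^sup>2 = q (X (T x)) x\<close> passes the bound on to \<open>T\<close>.\<close>

lemma semi_adjoint_pair_semi_ops:
  fixes A T :: "'a::chilbert_space \<Rightarrow> 'a"
  assumes A: "bounded_clinear A" "positive_op A" and T: "T \<in> semi_ops A"
  shows "\<exists>K. semi_adjoint_pair (semi_inner A) T (semi_adjoint A T) K"
proof -
  interpret q: semi_inner_form "semi_inner A"
    by (rule semi_inner_form_semi_inner[OF A])
  let ?X = "semi_adjoint A T"
  interpret A: bounded_linear A using A(1) by (simp add: bounded_clinear_def)
  have T_lin: "bounded_clinear T"
    using T by (simp add: semi_ops_def)
  interpret T: bounded_linear T using T_lin by (simp add: bounded_clinear_def)
  have X_lin: "bounded_clinear ?X"
    by (rule bounded_clinear_semi_adjoint[OF A T])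
  interpret X: bounded_linear ?X using X_lin by (simp add: bounded_clinear_def)
  have adj: "semi_inner A (T x) y = semi_inner A x (?X y)" for x y
    by (rule semi_inner_semi_adjoint[OF A T])
  have adj': "semi_inner A (?X x) y = semi_inner A x (T y)" for x y
    using adj[of y x] q.q_commute by metis
  obtain a where a: "a > 0" "\<And>x. norm (A x) \<le> norm x * a"
    using A.pos_bounded by blast
  have s_le: "q.s x \<le> sqrt a * norm x" for x
  proof -
    have "(q.s x)\<^sup>2 = inner (A x) x"
      by (simp add: q.s_squared semi_inner_def inner_eq_Re_cinner)
    also have "\<dots> \<le> norm (A x) * norm x"
      by (rule norm_cauchy_schwarz)
    also have "\<dots> \<le> norm x * a * norm x"
      by (intro mult_right_mono a) simp
    also have "\<dots> = (sqrt a * norm x)\<^sup>2"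
      using a(1) by (simp add: power_mult_distrib power2_eq_square)
    finally show ?thesis
      using a(1) by (simp add: power2_le_iff_abs_le)
  qed
  let ?S = "\<lambda>x. ?X (T x)"
  interpret S: bounded_linear ?S
    by (rule bounded_linear_compose[OF X.bounded_linear_axioms T.bounded_linear_axioms])
  obtain K where K: "K > 0" "\<And>x. norm (?S x) \<le> norm x * K"
    using S.pos_bounded by blast
  have S_bound: "q.s (?S x) \<le> K * q.s x" for x
  proof (rule q.symmetric_bound_of_power_growth[OF _ K(1)])
    show "semi_inner A (?S x) y = semi_inner A x (?S y)" for x y
      by (simp add: adj' adj)
    have "norm ((?S ^^ k) x) \<le> norm x * K ^ k" for k
    proof (induction k)
      case (Suc k)
      then show ?case
        using order_trans[OF K(2) mult_right_mono[OF Suc less_imp_le[OF K(1)]]]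
        by (simp add: mult_ac)
    qed simp
    then show "q.s ((?S ^^ k) x) \<le> (sqrt a * norm x) * K ^ k" for k
      using order_trans[OF s_le mult_left_mono[of _ "norm x * K ^ k" "sqrt a"]] a(1)
      by (simp add: mult.assoc)
  qed
  have "q.s (T x) \<le> sqrt K * q.s x" for x
  proof -
    have "(q.s (T x))\<^sup>2 \<le> q.s (?S x) * q.s x"
      using q.cauchy_schwarz[of "?S x" x] complex_Re_le_cmod[of "semi_inner A (?S x) x"]
      by (simp add: q.s_squared adj')
    also have "\<dots> \<le> K * q.s x * q.s x"
      by (intro mult_right_mono S_bound) simp
    also have "\<dots> = (sqrt K * q.s x)\<^sup>2"
      using K(1) by (simp add: power_mult_distrib power2_eq_square)
    finally show ?thesis
      using K(1) by (simp add: power2_le_iff_abs_le)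
  qed
  then have "semi_adjoint_pair (semi_inner A) T ?X (sqrt K)"
    using T_lin X_lin K(1)
    by unfold_locales (auto simp: adj T.add X.add bounded_clinear_def)
  then show ?thesis ..
qed

theorem theorem2p4:
  fixes A T :: "'a::chilbert_space \<Rightarrow> 'a"
  assumes "\<exists>x::'a. x \<noteq> 0"
    and "bounded_clinear A" and "positive_op A" and "A \<noteq> (\<lambda>x. 0)"
    and "T \<in> semi_ops A"
  shows "(davis_wielandt_radius A T = sqrt ((semi_numerical_radius A T)\<^sup>2 + semi_opnorm A T ^ 4)
      \<longleftrightarrow> (\<exists>x :: nat \<Rightarrow> 'a. (\<forall>n. semi_norm A (x n) = 1) \<and>
            (\<lambda>n. cmod (semi_inner A ((T \<circ> T) (x n)) (x n))) \<longlonglongrightarrow> (semi_opnorm A T)\<^sup>2))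
    \<and> ((\<exists>x :: nat \<Rightarrow> 'a. (\<forall>n. semi_norm A (x n) = 1) \<and>
            (\<lambda>n. cmod (semi_inner A ((T \<circ> T) (x n)) (x n))) \<longlonglongrightarrow> (semi_opnorm A T)\<^sup>2)
      \<longleftrightarrow> (\<exists>x :: nat \<Rightarrow> 'a. (\<forall>n. semi_norm A (x n) = 1) \<and>
            (\<lambda>n. cmod (semi_inner A ((T \<circ> semi_adjoint A T \<circ> T) (x n)) (x n)))
              \<longlonglongrightarrow> semi_opnorm A T ^ 3))
    \<and> ((\<exists>x :: nat \<Rightarrow> 'a. (\<forall>n. semi_norm A (x n) = 1) \<and>
            (\<lambda>n. cmod (semi_inner A ((T \<circ> semi_adjoint A T \<circ> T) (x n)) (x n)))
              \<longlonglongrightarrow> semi_opnorm A T ^ 3)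
      \<longleftrightarrow> semi_numerical_radius A (T \<circ> T) = (semi_opnorm A T)\<^sup>2)"
proof -
  let ?q = "semi_inner A" and ?X = "semi_adjoint A T"
  define N where "N = semi_opnorm A T"
  define w where "w = semi_numerical_radius A T"
  obtain K where "semi_adjoint_pair ?q T ?X K"
    using semi_adjoint_pair_semi_ops assms(2,3,5) by blast
  then interpret k: semi_adjoint_pair ?q T ?X K .
  have s_eq: "semi_norm A = k.s"
    by (rule ext) (simp add: semi_norm_def k.s_def)
  \<comment> \<open>If the seminorm vanished identically, Cauchy-Schwarz at \<open>x\<close> and
    \<open>A x\<close> would give \<open>(norm (A x))\<^sup>2 = 0\<close> for all
    \<open>x\<close>.\<close>
  have "\<exists>x. k.s x \<noteq> 0"
  proof (rule ccontr)
    assume "\<nexists>x. k.s x \<noteq> 0"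
    then have "cmod (?q x (A x)) \<le> 0" for x
      using k.cauchy_schwarz[of x "A x"] by simp
    then have "A x = 0" for x
      by (simp add: semi_inner_def cinner_self)
    then show False
      using assms(4) by auto
  qed
  then have unit: "\<exists>x. k.s x = 1"
    using k.exists_unit by blast
  have N_bdd: "bdd_above ((\<lambda>x. k.s (T x)) ` {x. k.s x = 1})"
    using k.T_bound by (intro bdd_aboveI2[of _ _ K]) (metis mem_Collect_eq mult.right_neutral)
  have N_upper: "k.s (T x) \<le> N" if "k.s x = 1" for x
    unfolding N_def semi_opnorm_def s_eq using that by (intro cSUP_upper N_bdd) simp
  have T_bound: "k.s (T x) \<le> N * k.s x" for x
  proof -
    have "k.s (T x) \<le> N * k.s x ^ 1"
    proof (rule k.bound_of_unit_bound[OF N_upper])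
      show "k.s (T x) \<le> 0" if "k.s x = 0" for x
        using k.T_bound[of x] that by simp
    qed (simp_all add: k.T_scaleC k.s_scaleC)
    then show ?thesis
      by simp
  qed
  have "0 \<le> N"
    using unit N_upper k.s_nonneg by (meson order_trans)
  \<comment> \<open>The locale is entered again with the operator norm as bound, the constant to
    which the four conditions refer.\<close>
  then interpret p: semi_adjoint_pair ?q T ?X N
    by unfold_locales (simp_all add: k.T_add k.T_scaleC k.X_add k.X_scaleC k.adjoint T_bound)
  have numerical_le: "cmod (?q (T x) x) \<le> N" if "k.s x = 1" for x
    using p.numerical_le[of x] that by simp
  have w_bdd: "bdd_above ((\<lambda>x. cmod (?q (T x) x)) ` {x. k.s x = 1})"
    using numerical_le by (intro bdd_aboveI2[of _ _ N]) simp
  have w_upper: "cmod (?q (T x) x) \<le> w" if "k.s x = 1" for x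
    unfolding w_def semi_numerical_radius_def s_eq using that by (intro cSUP_upper w_bdd) simp
  have w: "cmod (?q (T x) x) \<le> w * (k.s x)\<^sup>2" for x
  proof (rule k.bound_of_unit_bound[OF w_upper])
    show "cmod (?q (T x) x) \<le> 0" if "k.s x = 0" for x
      using p.numerical_le[of x] that by simp
    show "cmod (?q (T (c *\<^sub>C x)) (c *\<^sub>C x)) = (cmod c)\<^sup>2 * cmod (?q (T x) x)" for c x
      by (simp add: k.T_scaleC k.q_simps norm_mult power2_eq_square)
  qed simp_all
  have wN: "w \<le> N"
    unfolding w_def semi_numerical_radius_def s_eq using unit numerical_le by (intro cSUP_least) auto
  have w0: "0 \<le> w"
    using unit w_upper norm_ge_zero by (meson order_trans)
  have "davis_wielandt_radius A T = sqrt (w\<^sup>2 + N ^ 4)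
    \<longleftrightarrow> k.approached (\<lambda>x. sqrt ((cmod (?q (T x) x))\<^sup>2 + k.s (T x) ^ 4)) (sqrt (w\<^sup>2 + N ^ 4))"
    unfolding davis_wielandt_radius_def s_eq
  proof (rule k.SUP_eq_iff_approached[OF unit])
    fix x assume "k.s x = 1"
    then show "sqrt ((cmod (?q (T x) x))\<^sup>2 + k.s (T x) ^ 4) \<le> sqrt (w\<^sup>2 + N ^ 4)"
      using w_upper N_upper by (intro real_sqrt_le_mono add_mono power_mono) auto
  qed
  also have "\<dots> \<longleftrightarrow> k.approached (\<lambda>x. cmod (?q (T x) x)) N"
    by (rule p.approached_davis_wielandt_iff[OF w wN w0])
  finally have dw: "davis_wielandt_radius A T = sqrt (w\<^sup>2 + N ^ 4)
    \<longleftrightarrow> k.approached (\<lambda>x. cmod (?q (T x) x)) N" .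
  have sq: "semi_numerical_radius A (T \<circ> T) = N\<^sup>2
    \<longleftrightarrow> k.approached (\<lambda>x. cmod (?q ((T \<circ> T) x) x)) (N\<^sup>2)"
    unfolding semi_numerical_radius_def s_eq
  proof (rule k.SUP_eq_iff_approached[OF unit])
    fix x assume x: "k.s x = 1"
    have "cmod (?q (T (T x)) x) \<le> k.s (T (T x))"
      using k.cauchy_schwarz[of "T (T x)" x] x by simp
    also have "\<dots> \<le> N * (N * k.s x)"
      by (rule order_trans[OF T_bound mult_left_mono[OF T_bound p.N_nonneg]])
    finally show "cmod (?q ((T \<circ> T) x) x) \<le> N\<^sup>2"
      using x by (simp add: power2_eq_square)
  qed
  \<comment> \<open>Conditions (1), (2) and (3) each amount to numerical values approaching
    \<open>N\<close>; \<open>sq\<close> reduces condition (4) to (2).\<close>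
  note iffs = p.approached_square_iff p.approached_TXT_iff dw
  show ?thesis
    using iffs sq unfolding k.approached_def s_eq N_def[symmetric] w_def[symmetric] comp_apply
    by blast
qed

end
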